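(* Let $\alpha\in\mathbb{C}$ with $\operatorname{Re}(\alpha)<0$ and let $n\ge N_{\operatorname{Re}(\alpha)}$ be an integer. 1. If $j$ is odd with $3\le j\le n$, then $\|v_{\alpha,n,j}\|_2=|1-\alpha|\sqrt{\frac{n}{2}\lambda_{\alpha,n,j}}$. 2. If $j$ is even with $4\le j\le n$, then $$\|v_{\alpha,n,j}\|_2=\sqrt{\nu_\alpha(d_{n,j})\,n}+O_\alpha\left(\frac{1}{\sqrt{n}}\right),$$ where the $O_\alpha(1/\sqrt n)$ term is uniform in $j$ (the implied constant depends only on $\alpha$). 3. As $n\to\infty$, $$\|v_{\alpha,n,1}\|_2=\mu_\alpha\,(1-2\operatorname{Re}(\alpha))^n+O(n),$$ where the implied constant may depend on $\alpha$.
   Context: For an integer $n\ge3$ and $\alpha\in\mathbb{C}$, $L_{\alpha,n}$ is the complex $n\times n$ matrix whose entries are: $(1,1)$ entry $1+\overline{\alpha}$; $(1,n)$ entry $-\overline{\alpha}$; $(n,1)$ entry $-\alpha$; $(n,n)$ entry $1+\alpha$; $(k,k)$ entries $2$ for $2\le k\le n-1$; $(k,k+1)$ and $(k+1,k)$ entries $-1$ for $1\le k\le n-1$; all other entries $0$. The characteristic polynomial of $L_{\alpha,n}$ equals that of the real symmetric matrix $L_{\operatorname{Re}(\alpha),n}$, so its eigenvalues, counted with multiplicity, are real and are enumerated as $\lambda_{\alpha,n,1}\le\dots\le\lambda_{\alpha,n,n}$. For $a<0$ put $\varkappa_a=\frac{a-1}{a}$, $N_a=\max\{3,\lfloor\varkappa_a\rfloor+1\}$,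 and $\eta_a(x)=2\arctan\left(\varkappa_a\tan\frac x2\right)-\pi$ for $x\in[0,\pi]$ (with $\eta_a(\pi)=0$ by continuity). Put $d_{n,j}=\frac{(j-1)\pi}{n}$ and $g(x)=4\sin^2(x/2)$ for all real $x$. For $n\ge N_{\operatorname{Re}(\alpha)}$ one has $\lambda_{\alpha,n,1}<0$ and $\lambda_{\alpha,n,j}\in[0,4]$ for $j\ge2$; $z_{\alpha,n,j}\in[0,\pi]$ is defined by $g(z_{\alpha,n,j})=\lambda_{\alpha,n,j}$ for $j\ge2$, and $s_{\alpha,n}>0$ by $-4\sinh^2(s_{\alpha,n}/2)=\lambda_{\alpha,n,1}$. The vectors $v_{\alpha,n,j}=[v_{\alpha,n,j,k}]_{k=1}^n$ (eigenvectors of $L_{\alpha,n}$ for $\lambda_{\alpha,n,j}$) are given for $3\le j\le n$ by $$v_{\alpha,n,j,k}=\sin(kz_{\alpha,n,j})-(1-\overline{\alpha})\sin((k-1)z_{\alpha,n,j})+\overline{\alpha}\sin((n-k)z_{\alpha,n,j})$$ and for $j=1$ by $$v_{\alpha,n,1,k}=\sinh(ks_{\alpha,n})-(1-\overline{\alpha})\sinh((k-1)s_{\alpha,n})+\overline{\alpha}\sinh((n-k)s_{\alpha,n}).$$ For $x\in[0,\pi]$, $$\nu_\alpha(x)=\frac{1-\operatorname{Re}(\alpha)}{2}g(x)-\frac{\operatorname{Re}(\alpha)}{2}g(\eta_{\operatorname{Re}(\alpha)}(x))+\frac{\operatorname{Re}(\alpha)-|\alpha|^2}{2}g(x-\eta_{\operatorname{Re}(\alpha)}(x))+2|\alpha|^2,$$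 and $\mu_\alpha=\dfrac{|\alpha|}{2\sqrt{2(\operatorname{Re}(\alpha)^2-\operatorname{Re}(\alpha))}}$. *)

theory Defs
  imports
    "HOL-Analysis.L2_Norm"
    "HOL-Library.Landau_Symbols"
    "Jordan_Normal_Form.Char_Poly"
begin

text \<open>Entry \<open>(j, k)\<close> of the matrix \<open>L\<^sub>\<alpha>\<^sub>,\<^sub>n\<close>, with rows and columns numbered from 1 to \<open>n\<close>;
  \<open>lap_mat\<close> shifts to the 0-based indexing of the type \<open>mat\<close>.\<close>

definition lap_entry :: "complex \<Rightarrow> nat \<Rightarrow> nat \<Rightarrow> nat \<Rightarrow> complex" where
  "lap_entry \<alpha> n j k =
     (if j = 1 \<and> k = 1 then 1 + cnj \<alpha>
      else if j = 1 \<and> k = n then - cnj \<alpha>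
      else if j = n \<and> k = 1 then - \<alpha>
      else if j = n \<and> k = n then 1 + \<alpha>
      else if j = k then 2
      else if k = j + 1 \<or> j = k + 1 then - 1
      else 0)"

definition lap_mat :: "complex \<Rightarrow> nat \<Rightarrow> complex mat" where
  "lap_mat \<alpha> n = mat n n (\<lambda>(j, k). lap_entry \<alpha> n (j + 1) (k + 1))"

text \<open>\<open>lap_eigval \<alpha> n j\<close> is the \<open>j\<close>-th smallest eigenvalue, \<open>1 \<le> j \<le> n\<close>, counted with algebraic
  multiplicity. The characteristic polynomial of \<open>lap_mat \<alpha> n\<close> is that of the real symmetric matrix
  \<open>lap_mat (Re \<alpha>) n\<close>, so all its roots are real and \<open>Re\<close> merely changes their type.\<close>

definition lap_eigval :: "complex \<Rightarrow> nat \<Rightarrow> nat \<Rightarrow> real" where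
  "lap_eigval \<alpha> n j =
     sorted_list_of_multiset (image_mset Re (proots (char_poly (lap_mat \<alpha> n)))) ! (j - 1)"

definition kappa :: "real \<Rightarrow> real" where
  "kappa a = (a - 1) / a"

definition N_min :: "real \<Rightarrow> nat" where
  "N_min a = nat (max 3 (\<lfloor>kappa a\<rfloor> + 1))"

text \<open>The value at \<open>\<pi>\<close> is the limit; the formula itself would yield \<open>- \<pi>\<close> there, since
  \<open>tan (\<pi>/2) = 0\<close> in HOL.\<close>

definition eta :: "real \<Rightarrow> real \<Rightarrow> real" where
  "eta a x = (if x = pi then 0 else 2 * arctan (kappa a * tan (x / 2)) - pi)"

definition node :: "nat \<Rightarrow> nat \<Rightarrow> real" where
  "node n j = (real j - 1) * pi / real n"

definition gfun :: "real \<Rightarrow> real" where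
  "gfun x = 4 * (sin (x / 2))\<^sup>2"

definition zeta :: "complex \<Rightarrow> nat \<Rightarrow> nat \<Rightarrow> real" where
  "zeta \<alpha> n j = (THE z. 0 \<le> z \<and> z \<le> pi \<and> gfun z = lap_eigval \<alpha> n j)"

definition sparam :: "complex \<Rightarrow> nat \<Rightarrow> real" where
  "sparam \<alpha> n = (THE s. s > 0 \<and> - 4 * (sinh (s / 2))\<^sup>2 = lap_eigval \<alpha> n 1)"

text \<open>Component \<open>k\<close>, \<open>1 \<le> k \<le> n\<close>, of the eigenvector for the \<open>j\<close>-th eigenvalue. Only \<open>j = 1\<close> and
  \<open>3 \<le> j \<le> n\<close> are meaningful: the second eigenvalue is 0, and for it the sine formula yields the
  zero vector rather than an eigenvector.\<close>

definition eigvec :: "complex \<Rightarrow> nat \<Rightarrow> nat \<Rightarrow> nat \<Rightarrow> complex" where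
  "eigvec \<alpha> n j k =
     (if j = 1 then
        of_real (sinh (real k * sparam \<alpha> n))
        - (1 - cnj \<alpha>) * of_real (sinh ((real k - 1) * sparam \<alpha> n))
        + cnj \<alpha> * of_real (sinh ((real n - real k) * sparam \<alpha> n))
      else
        of_real (sin (real k * zeta \<alpha> n j))
        - (1 - cnj \<alpha>) * of_real (sin ((real k - 1) * zeta \<alpha> n j))
        + cnj \<alpha> * of_real (sin ((real n - real k) * zeta \<alpha> n j)))"

definition eigvec_norm :: "complex \<Rightarrow> nat \<Rightarrow> nat \<Rightarrow> real" where
  "eigvec_norm \<alpha> n j = L2_set (\<lambda>k. cmod (eigvec \<alpha> n j k)) {1..n}"

definition nu :: "complex \<Rightarrow> real \<Rightarrow> real" where
  "nu \<alpha> x =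
     (1 - Re \<alpha>) / 2 * gfun x
     - Re \<alpha> / 2 * gfun (eta (Re \<alpha>) x)
     + (Re \<alpha> - (cmod \<alpha>)\<^sup>2) / 2 * gfun (x - eta (Re \<alpha>) x)
     + 2 * (cmod \<alpha>)\<^sup>2"

definition mu :: "complex \<Rightarrow> real" where
  "mu \<alpha> = cmod \<alpha> / (2 * sqrt (2 * ((Re \<alpha>)\<^sup>2 - Re \<alpha>)))"

end

theory Submission
  imports Defs
begin

text \<open>Write \<open>a = Re \<alpha>\<close> and \<open>\<beta> = (Im \<alpha> / Re \<alpha>)\<^sup>2\<close>. If \<open>S\<close> solves the recurrence
\<open>S\<^sub>k\<^sub>+\<^sub>2 = t S\<^sub>k\<^sub>+\<^sub>1 - S\<^sub>k\<close> with \<open>S\<^sub>0 = 0\<close>, then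
\<open>v\<^sub>k = S\<^sub>k - (1 - cnj \<alpha>) S\<^sub>k\<^sub>-\<^sub>1 + cnj \<alpha> S\<^sub>n\<^sub>-\<^sub>k\<close> satisfies every row of
\<open>L v = (2 - t) v\<close> but the last. The last row is one real equation for \<open>t\<close>, the closing equation, which
involves \<open>\<alpha>\<close> only through \<open>a\<close> (\<open>lap_mat_root_if_closing\<close>).

For \<open>S\<^sub>k = sin (k z)\<close> the closing equation factors. One factor, \<open>sin (n z / 2)\<close>, vanishes at the nodes with odd
index. The other says \<open>tan (n z / 2) = \<kappa> tan (z / 2)\<close>, that is, \<open>n z = (j - 1) \<pi> + \<eta>(z)\<close> with \<open>j\<close> even; as
\<open>-\<pi> < \<eta> < 0\<close> inside \<open>(0, \<pi>)\<close>, the intermediate value theorem puts a solution strictly between the nodes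
\<open>j - 1\<close> and \<open>j\<close>. For \<open>S\<^sub>k = sinh (k s)\<close> it says \<open>tanh (n s / 2) = \<kappa> tanh (s / 2)\<close>, which has a
solution \<open>s > 0\<close> because \<open>1 < \<kappa> < n\<close>. With the eigenvalue 0 of the constant vector these are \<open>n\<close> distinct real
roots of a polynomial of degree \<open>n\<close>, so they are the whole spectrum, and their order is evident
(\<open>lap_eigval_eq\<close>); the count also shows that the chosen solutions are the only ones.

The norms rest on one identity. Put \<open>h = z / 2\<close>, \<open>\<phi> = n z / 2\<close> and \<open>\<theta>\<^sub>k = (2 k - 1) h\<close>. The second factor of the
closing equation reads \<open>a sin (\<phi> - h) = - sin h cos \<phi>\<close>, and with it the vector becomes
\<open>v\<^sub>k = 2 sin h (- sin \<phi> sin (\<theta>\<^sub>k - \<phi>) + \<i> (Im \<alpha> / Re \<alpha>) cos \<phi> cos (\<theta>\<^sub>k - \<phi>))\<close>.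
Hence \<open>\<parallel>v\<parallel>\<^sup>2 = 2 sin\<^sup>2 h (sin\<^sup>2 \<phi> (n - M) + \<beta> cos\<^sup>2 \<phi> (n + M))\<close> with
\<open>M = sin (n z) / sin z\<close>. Since \<open>\<nu>(z) = 2 sin\<^sup>2 h (sin\<^sup>2 \<phi> + \<beta> cos\<^sup>2 \<phi>)\<close> and \<open>0 \<le> M \<le> \<kappa>\<close>, the squared norm is
\<open>\<nu>(z) (n + O(1))\<close>. This relative form of the error matters, because \<open>\<nu>\<close> vanishes at 0, to the fourth
order when \<open>\<alpha>\<close> is real. It yields \<open>\<parallel>v\<parallel> = \<surd>(\<nu>(z) n) + O(1 / \<surd>n)\<close>; finally \<open>\<surd>\<nu>\<close> is Lipschitz
and \<open>z\<close> is within \<open>\<pi> / n\<close> of the node.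

The same identity with hyperbolic functions makes \<open>\<parallel>v\<^sub>1\<parallel>\<^sup>2\<close> equal to \<open>\<mu>\<^sup>2 q\<^sup>2 + O(n q)\<close> for
\<open>q = e\<^sup>n\<^sup>s\<close>, so \<open>\<parallel>v\<^sub>1\<parallel> = \<mu> q + O(n)\<close>. In terms of \<open>q\<close> and \<open>\<omega> = 1 - 2 a\<close> the closing equation is
\<open>e\<^sup>s = (\<omega> q + 1) / (q + \<omega>)\<close>; thus \<open>e\<^sup>s\<close> differs from \<open>\<omega>\<close> by \<open>O(1 / q)\<close>, and \<open>q\<close> from \<open>\<omega>\<^sup>n\<close> by \<open>O(n)\<close>.\<close>

section \<open>Characteristic roots from three-term recurrences\<close>

lemma lap_mat_carrier: "lap_mat \<alpha> n \<in> carrier_mat n n"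
  by (simp add: lap_mat_def)

lemma lap_mat_root_if_rows:
  fixes w :: "nat \<Rightarrow> complex"
  assumes n: "3 \<le> n"
    and first: "(1 + cnj \<alpha>) * w 1 - w 2 - cnj \<alpha> * w n = c * w 1"
    and inner: "\<And>k. 2 \<le> k \<Longrightarrow> k < n \<Longrightarrow> 2 * w k - w (k - 1) - w (k + 1) = c * w k"
    and last: "(1 + \<alpha>) * w n - w (n - 1) - \<alpha> * w 1 = c * w n"
    and nz: "k0 \<in> {1..n}" "w k0 \<noteq> 0"
  shows "poly (char_poly (lap_mat \<alpha> n)) c = 0"
proof -
  define v where "v = vec n (\<lambda>i. w (i + 1))"
  have row: "(\<Sum>k<n. lap_entry \<alpha> n (i + 1) (k + 1) * w (k + 1)) = c * w (i + 1)"
    if i: "i < n" for i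
  proof -
    consider "i = 0" | "i = n - 1" | "0 < i" "i < n - 1" using i by linarith
    then show ?thesis
    proof cases
      case 1
      \<comment> \<open>At most three entries of a row are nonzero; \<open>n \<ge> 3\<close> keeps them in distinct columns.\<close>
      have "(\<Sum>k<n. lap_entry \<alpha> n (i + 1) (k + 1) * w (k + 1))
          = (\<Sum>k\<in>{0, 1, n - 1}. lap_entry \<alpha> n (i + 1) (k + 1) * w (k + 1))"
        using n 1 by (intro sum.mono_neutral_right) (auto simp: lap_entry_def)
      also have "\<dots> = (1 + cnj \<alpha>) * w 1 - w 2 - cnj \<alpha> * w n"
        using n 1 by (auto simp: lap_entry_def numeral_2_eq_2)
      finally show ?thesis using first 1 by simp
    next
      case 2
      have "(\<Sum>k<n. lap_entry \<alpha> n (i + 1) (k + 1) * w (k + 1))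
          = (\<Sum>k\<in>{0, n - 2, n - 1}. lap_entry \<alpha> n (i + 1) (k + 1) * w (k + 1))"
        using n 2 by (intro sum.mono_neutral_right) (auto simp: lap_entry_def)
      also have "\<dots> = (1 + \<alpha>) * w n - w (n - 1) - \<alpha> * w 1"
      proof -
        have "Suc (n - 2) = n - 1" "Suc (n - 1) = n" using n by auto
        then show ?thesis
          using n 2 by (auto simp: lap_entry_def)
      qed
      finally show ?thesis using last 2 n by simp
    next
      case 3
      obtain i' where i': "i = Suc i'" using 3(1) by (cases i) auto
      have "(\<Sum>k<n. lap_entry \<alpha> n (i + 1) (k + 1) * w (k + 1))
          = (\<Sum>k\<in>{i - 1, i, i + 1}. lap_entry \<alpha> n (i + 1) (k + 1) * w (k + 1))"
        using n 3 by (intro sum.mono_neutral_right) (auto simp: lap_entry_def)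
      also have "\<dots> = 2 * w (i + 1) - w i - w (i + 2)"
        using n 3 unfolding i' by (auto simp: lap_entry_def)
      finally show ?thesis using inner[of "i + 1"] 3 by simp
    qed
  qed
  have "lap_mat \<alpha> n *\<^sub>v v = c \<cdot>\<^sub>v v"
    using row by (intro eq_vecI)
      (auto simp: lap_mat_def v_def scalar_prod_def atLeast0LessThan)
  moreover have "v \<noteq> 0\<^sub>v n"
  proof
    assume "v = 0\<^sub>v n"
    moreover have "k0 - 1 < n" "Suc (k0 - 1) = k0" using nz(1) by auto
    ultimately have "w k0 = 0" by (metis index_vec index_zero_vec(1) v_def Suc_eq_plus1)
    then show False using nz by simp
  qed
  ultimately have "eigenvector (lap_mat \<alpha> n) v c"
    unfolding eigenvector_def by (simp add: lap_mat_def v_def)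
  then show ?thesis
    using eigenvalue_root_char_poly[OF lap_mat_carrier] unfolding eigenvalue_def by blast
qed

lemma lap_mat_root_zero:
  assumes "3 \<le> n"
  shows "poly (char_poly (lap_mat \<alpha> n)) 0 = 0"
  using assms by (intro lap_mat_root_if_rows[where w = "\<lambda>_. 1" and ?k0.0 = 1]) auto

text \<open>Row 1 holds for this vector whatever \<open>t\<close> is, and the rows in between hold by the recurrence; row \<open>n\<close> is the closing
equation. The vector is nonzero: if both end components vanished, then \<open>\<alpha>\<close> would be real with
\<open>S\<^sub>1 = - \<alpha> S\<^sub>n\<^sub>-\<^sub>1\<close> and \<open>S\<^sub>n = (1 - \<alpha>) S\<^sub>n\<^sub>-\<^sub>1\<close>, and the closing equation together with the recurrence would
give \<open>t = 2\<close>.\<close>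

lemma lap_mat_root_if_closing:
  fixes S :: "nat \<Rightarrow> real" and t :: real
  assumes n: "3 \<le> n"
    and rec: "\<And>k. S (k + 2) = t * S (k + 1) - S k"
    and S0: "S 0 = 0" and S1: "S 1 \<noteq> 0" and t: "t \<noteq> 2"
    and re: "Re \<alpha> \<noteq> 1"
    and closing: "S (n + 1) = (2 - 2 * Re \<alpha>) * S n - (1 - 2 * Re \<alpha>) * S (n - 1) + 2 * Re \<alpha> * S 1"
  shows "poly (char_poly (lap_mat \<alpha> n)) (of_real (2 - t)) = 0"
proof -
  define s where "s k = complex_of_real (S k)" for k
  define w where "w k = s k - (1 - cnj \<alpha>) * s (k - 1) + cnj \<alpha> * s (n - k)" for k
  have srec: "s (k + 2) = of_real t * s (k + 1) - s k" for k
    unfolding s_def rec by simp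
  have s0: "s 0 = 0" by (simp add: s_def S0)
  have a: "complex_of_real (2 * Re \<alpha>) = \<alpha> + cnj \<alpha>"
    by (simp add: complex_eq_iff)
  have sclosing: "s (n + 1) = (2 - (\<alpha> + cnj \<alpha>)) * s n - (1 - (\<alpha> + cnj \<alpha>)) * s (n - 1) + (\<alpha> + cnj \<alpha>) * s 1"
    unfolding s_def closing a[symmetric] by simp
  have n2: "s n = of_real t * s (n - 1) - s (n - 2)" "s (n + 1) = of_real t * s n - s (n - 1)"
    using srec[of "n - 2"] srec[of "n - 1"] n by (simp_all add: eval_nat_numeral Suc_diff_Suc)
  have s2: "s 2 = of_real t * s 1" using srec[of 0] s0 by (simp add: numeral_2_eq_2)
  have ends: "w 1 = s 1 + cnj \<alpha> * s (n - 1)" "w n = s n - (1 - cnj \<alpha>) * s (n - 1)"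
    by (simp_all add: w_def s0)
  have first: "(1 + cnj \<alpha>) * w 1 - w 2 - cnj \<alpha> * w n = of_real (2 - t) * w 1"
    unfolding ends by (simp add: w_def n2(1) s2 numeral_2_eq_2[symmetric]) (simp add: algebra_simps)
  have inner: "2 * w k - w (k - 1) - w (k + 1) = of_real (2 - t) * w k" if k: "2 \<le> k" "k < n" for k
  proof -
    obtain i where i: "k = i + 2" using k(1) by (metis add.commute le_Suc_ex)
    obtain m where m: "n = m + k + 1" using k(2) by (metis add.commute less_imp_Suc_add Suc_eq_plus1)
    have e: "s (k + 1) - of_real t * s k + s (k - 1) = 0"
        "s k - of_real t * s (k - 1) + s (k - 2) = 0"
        "s (n - (k + 1)) - of_real t * s (n - k) + s (n - (k - 1)) = 0"
      using srec[of "i + 1"] srec[of i] srec[of m] i m by simp_all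
    have W: "w (k + 1) = s (k + 1) - (1 - cnj \<alpha>) * s k + cnj \<alpha> * s (n - (k + 1))"
        "w k = s k - (1 - cnj \<alpha>) * s (k - 1) + cnj \<alpha> * s (n - k)"
        "w (k - 1) = s (k - 1) - (1 - cnj \<alpha>) * s (k - 2) + cnj \<alpha> * s (n - (k - 1))"
      unfolding w_def by (simp_all add: numeral_2_eq_2)
    have "w (k + 1) - of_real t * w k + w (k - 1)
        = (s (k + 1) - of_real t * s k + s (k - 1))
          - (1 - cnj \<alpha>) * (s k - of_real t * s (k - 1) + s (k - 2))
          + cnj \<alpha> * (s (n - (k + 1)) - of_real t * s (n - k) + s (n - (k - 1)))"
      unfolding W by (simp only: algebra_simps)
    then have "w (k + 1) = of_real t * w k - w (k - 1)"
      unfolding e by (simp add: algebra_simps)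
    then show ?thesis by (simp add: algebra_simps)
  qed
  have last: "(1 + \<alpha>) * w n - w (n - 1) - \<alpha> * w 1 = of_real (2 - t) * w n"
  proof -
    have W: "w (n - 1) = s (n - 1) - (1 - cnj \<alpha>) * s (n - 2) + cnj \<alpha> * s 1"
      using n by (simp add: w_def numeral_2_eq_2)
    have ts: "of_real t * s n = s (n + 1) + s (n - 1)" using n2(2) by simp
    have e: "of_real t * s n - (2 - (\<alpha> + cnj \<alpha>)) * s n - (\<alpha> + cnj \<alpha>) * s (n - 1) - (\<alpha> + cnj \<alpha>) * s 1 = 0"
        "of_real t * s (n - 1) - s n - s (n - 2) = 0"
      unfolding ts sclosing using n2(1) by (simp_all add: algebra_simps)
    have "(1 + \<alpha>) * w n - w (n - 1) - \<alpha> * w 1 - of_real (2 - t) * w n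
        = (of_real t * s n - (2 - (\<alpha> + cnj \<alpha>)) * s n - (\<alpha> + cnj \<alpha>) * s (n - 1) - (\<alpha> + cnj \<alpha>) * s 1)
          - (1 - cnj \<alpha>) * (of_real t * s (n - 1) - s n - s (n - 2))"
      unfolding W ends by (simp add: algebra_simps)
    then show ?thesis unfolding e by simp
  qed
  \<comment> \<open>If both ends vanished, comparing real parts would force \<open>t = 2\<close>.\<close>
  have "w 1 \<noteq> 0 \<or> w n \<noteq> 0"
  proof (rule ccontr)
    assume "\<not> ?thesis"
    then have z: "s 1 = - (cnj \<alpha> * s (n - 1))" "s n = (1 - cnj \<alpha>) * s (n - 1)"
      unfolding ends by (auto simp: eq_neg_iff_add_eq_0)
    have S1': "S 1 = - (Re \<alpha> * S (n - 1))" and "S n = (1 - Re \<alpha>) * S (n - 1)"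
      using z[unfolded s_def complex_eq_iff] by auto
    moreover note S1'
    moreover have "S (n + 1) = t * S n - S (n - 1)"
      using rec[of "n - 1"] n by (simp add: eval_nat_numeral Suc_diff_Suc)
    ultimately have "t * ((1 - Re \<alpha>) * S (n - 1)) - S (n - 1)
        = (2 - 2 * Re \<alpha>) * ((1 - Re \<alpha>) * S (n - 1)) - (1 - 2 * Re \<alpha>) * S (n - 1)
          + 2 * Re \<alpha> * - (Re \<alpha> * S (n - 1))"
      using closing by simp
    then have "(t - 2) * (1 - Re \<alpha>) * S (n - 1) = 0"
      by (simp add: algebra_simps)
    moreover have "S (n - 1) \<noteq> 0" using S1 S1' by auto
    ultimately show False using t re by simp
  qed
  then obtain k0 where "k0 \<in> {1..n}" "w k0 \<noteq> 0" using n
    by (meson atLeastAtMost_iff le_refl le_trans one_le_numeral)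
  then show ?thesis
    using lap_mat_root_if_rows[OF n first inner last] by blast
qed

text \<open>The \<open>n\<close> distinct values exhaust the root multiset of a polynomial of degree \<open>n\<close>, so every root is simple and
sorting the multiset returns the given enumeration.\<close>

lemma lap_eigval_eqI:
  fixes lam :: "nat \<Rightarrow> real"
  assumes mono: "strict_mono_on {1..n} lam"
    and root: "\<And>j. j \<in> {1..n} \<Longrightarrow> poly (char_poly (lap_mat \<alpha> n)) (of_real (lam j)) = 0"
    and j: "j \<in> {1..n}"
  shows "lap_eigval \<alpha> n j = lam j"
proof -
  let ?p = "char_poly (lap_mat \<alpha> n)"
  let ?R = "(\<lambda>j. complex_of_real (lam j)) ` {1..n}"
  have inj: "inj_on lam {1..n}" using strict_mono_on_imp_inj_on[OF mono] .
  have inj': "inj_on (\<lambda>j. complex_of_real (lam j)) {1..n}"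
  proof (rule inj_onI)
    fix x y assume "x \<in> {1..n}" "y \<in> {1..n}" "complex_of_real (lam x) = complex_of_real (lam y)"
    then show "x = y" using inj_onD[OF inj] by simp
  qed
  have dm: "degree ?p = n \<and> coeff ?p n = 1"
    by (rule degree_monic_char_poly[OF lap_mat_carrier])
  have p1: "degree ?p = n" by (rule dm[THEN conjunct1])
  have p2: "?p \<noteq> 0"
  proof
    assume "?p = 0"
    then show False using dm[THEN conjunct2] by (metis coeff_0 zero_neq_one)
  qed
  have "mset_set ?R \<subseteq># proots ?p"
  proof (rule mset_subset_eqI)
    fix x
    show "count (mset_set ?R) x \<le> count (proots ?p) x"
    proof (cases "x \<in> ?R")
      case True
      then have "order x ?p \<noteq> 0" using root p2 order_root by blast
      then show ?thesis using True p2 by simp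
    qed simp
  qed
  moreover have "size (proots ?p) = size (mset_set ?R)"
    using card_image[OF inj'] by (simp add: size_proots_complex p1 del: One_nat_def)
  ultimately have "proots ?p = mset_set ?R"
    by (metis mset_subset_size nless_le subset_mset.le_imp_less_or_eq)
  also have "\<dots> = image_mset (\<lambda>j. complex_of_real (lam j)) (mset_set {1..n})"
    by (rule image_mset_mset_set[OF inj', symmetric])
  also have "mset_set {1..n} = mset [1..<n + 1]"
    by (metis atLeastLessThanSuc_atLeastAtMost Suc_eq_plus1 mset_upt)
  finally have "image_mset Re (proots ?p) = mset (map lam [1..<n + 1])"
    by (simp add: multiset.map_comp comp_def flip: mset_map)
  moreover have "sorted (map lam [1..<n + 1])"
    unfolding sorted_wrt_map
    by (rule sorted_wrt_mono_rel[OF _ sorted_wrt_upt])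
       (use strict_mono_onD[OF mono] in \<open>auto simp del: One_nat_def intro: less_imp_le\<close>)
  ultimately have "lap_eigval \<alpha> n j = map lam [1..<n + 1] ! (j - 1)"
    unfolding lap_eigval_def by (metis sorted_list_of_multiset_mset sorted_sort_id)
  moreover have "j - 1 < length [1..<n + 1]" and "[1..<n + 1] ! (j - 1) = j"
    using j nth_upt[of 1 "j - 1" "n + 1"] by (simp_all del: upt_Suc, linarith+)
  ultimately show ?thesis by (metis nth_map)
qed

section \<open>The closing equation for sines and hyperbolic sines\<close>

lemma gfun_eq: "gfun x = 2 - 2 * cos x"
  using cos_double_sin[of "x / 2"] by (simp add: gfun_def)

lemma gfun_less_iff:
  assumes "0 \<le> x" "x \<le> pi" "0 \<le> y" "y \<le> pi"
  shows "gfun x < gfun y \<longleftrightarrow> x < y"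
  using cos_mono_less_eq[OF assms(3,4,1,2)] by (simp add: gfun_eq)

text \<open>With \<open>\<phi> = n z / 2\<close> and \<open>h = z / 2\<close>, the two sides of the closing equation for \<open>sin (k z)\<close> differ by
\<open>- 8 sin h sin \<phi> ((1 - a) sin h cos \<phi> + a sin \<phi> cos h)\<close>.\<close>

lemma lap_mat_root_sine:
  fixes z :: real
  assumes n: "3 \<le> n" and re: "Re \<alpha> < 0" and z: "0 < z" "z < pi"
    and closing: "sin (real n * z / 2) * ((1 - Re \<alpha>) * sin (z / 2) * cos (real n * z / 2)
       + Re \<alpha> * sin (real n * z / 2) * cos (z / 2)) = 0"
  shows "poly (char_poly (lap_mat \<alpha> n)) (of_real (gfun z)) = 0"
proof -
  define a S C s c where "a = Re \<alpha>" "S = sin (real n * z / 2)" "C = cos (real n * z / 2)"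
    "s = sin (z / 2)" "c = cos (z / 2)"
  note d = a_S_C_s_c_def
  have py: "C\<^sup>2 = 1 - S\<^sup>2" "c\<^sup>2 = 1 - s\<^sup>2"
    unfolding d by (rule cos_squared_eq)+
  have dbl: "sin (real n * z) = 2 * S * C" "cos (real n * z) = C\<^sup>2 - S\<^sup>2" "sin z = 2 * s * c" "cos z = c\<^sup>2 - s\<^sup>2"
    using sin_double[of "real n * z / 2"] cos_double[of "real n * z / 2"] sin_double[of "z / 2"] cos_double[of "z / 2"]
    by (simp_all add: d)
  have e: "real (n + 1) * z = real n * z + z" "real (n - 1) * z = real n * z - z"
    using n by (simp_all add: algebra_simps of_nat_diff)
  have nb: "sin (real (n + 1) * z) = 2 * S * C * (c\<^sup>2 - s\<^sup>2) + (C\<^sup>2 - S\<^sup>2) * (2 * s * c)"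
    "sin (real (n - 1) * z) = 2 * S * C * (c\<^sup>2 - s\<^sup>2) - (C\<^sup>2 - S\<^sup>2) * (2 * s * c)"
    unfolding e sin_add sin_diff dbl by (rule refl)+
  have cl: "S * ((1 - a) * s * C + a * S * c) = 0" using closing by (simp add: d)
  have "sin (real (n + 1) * z) = (2 - 2 * a) * sin (real n * z) - (1 - 2 * a) * sin (real (n - 1) * z) + 2 * a * sin (real 1 * z)"
  proof -
    have "sin (real (n + 1) * z) - ((2 - 2 * a) * sin (real n * z) - (1 - 2 * a) * sin (real (n - 1) * z) + 2 * a * sin z)
        = - 8 * s * (S * ((1 - a) * s * C + a * S * c))"
      unfolding nb dbl py by (simp add: power2_eq_square algebra_simps)
    then show ?thesis unfolding cl by simp
  qed
  moreover have "sin (real (k + 2) * z) = 2 * cos z * sin (real (k + 1) * z) - sin (real k * z)" for k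
  proof -
    have "sin (real (k + 2) * z) = sin (real (k + 1) * z + z)" "sin (real k * z) = sin (real (k + 1) * z - z)"
      by (simp_all add: algebra_simps)
    then show ?thesis by (simp add: sin_add sin_diff)
  qed
  moreover have "2 * cos z \<noteq> 2" using cos_monotone_0_pi[of 0 z] z by simp
  moreover have "sin (real 1 * z) \<noteq> 0" using sin_gt_zero[OF z] by simp
  moreover have "Re \<alpha> \<noteq> 1" using re by simp
  ultimately show ?thesis
    unfolding gfun_eq using lap_mat_root_if_closing[OF n, of "\<lambda>k. sin (real k * z)" "2 * cos z" \<alpha>]
    by (simp add: d)
qed

text \<open>The factorization is that of the sine case with hyperbolic functions; only the second factor can vanish for \<open>z > 0\<close>.\<close>

lemma lap_mat_root_sinh:
  fixes z :: real
  assumes n: "3 \<le> n" and re: "Re \<alpha> < 0" and z: "0 < z"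
    and closing: "(1 - Re \<alpha>) * sinh (z / 2) * cosh (real n * z / 2)
       + Re \<alpha> * sinh (real n * z / 2) * cosh (z / 2) = 0"
  shows "poly (char_poly (lap_mat \<alpha> n)) (of_real (- 4 * (sinh (z / 2))\<^sup>2)) = 0"
proof -
  define a S C s c where "a = Re \<alpha>" "S = sinh (real n * z / 2)" "C = cosh (real n * z / 2)"
    "s = sinh (z / 2)" "c = cosh (z / 2)"
  note d = a_S_C_s_c_def
  have py: "C\<^sup>2 = 1 + S\<^sup>2" "c\<^sup>2 = 1 + s\<^sup>2" by (simp_all add: d cosh_square_eq)
  have dbl: "sinh (real n * z) = 2 * S * C" "cosh (real n * z) = C\<^sup>2 + S\<^sup>2" "sinh z = 2 * s * c" "cosh z = c\<^sup>2 + s\<^sup>2"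
    using sinh_double[of "real n * z / 2"] cosh_double[of "real n * z / 2"] sinh_double[of "z / 2"] cosh_double[of "z / 2"]
    by (simp_all add: d)
  have e: "real (n + 1) * z = real n * z + z" "real (n - 1) * z = real n * z - z"
    using n by (simp_all add: algebra_simps of_nat_diff)
  have nb: "sinh (real (n + 1) * z) = 2 * S * C * (c\<^sup>2 + s\<^sup>2) + (C\<^sup>2 + S\<^sup>2) * (2 * s * c)"
    "sinh (real (n - 1) * z) = 2 * S * C * (c\<^sup>2 + s\<^sup>2) - (C\<^sup>2 + S\<^sup>2) * (2 * s * c)"
    unfolding e sinh_add sinh_diff dbl by (rule refl)+
  have cl: "(1 - a) * s * C + a * S * c = 0" using closing by (simp add: d)
  have "sinh (real (n + 1) * z) = (2 - 2 * a) * sinh (real n * z) - (1 - 2 * a) * sinh (real (n - 1) * z) + 2 * a * sinh (real 1 * z)"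
  proof -
    have "sinh (real (n + 1) * z) - ((2 - 2 * a) * sinh (real n * z) - (1 - 2 * a) * sinh (real (n - 1) * z) + 2 * a * sinh z)
        = 8 * s * S * ((1 - a) * s * C + a * S * c)"
      unfolding nb dbl py by (simp add: power2_eq_square algebra_simps)
    then show ?thesis unfolding cl by simp
  qed
  moreover have "sinh (real (k + 2) * z) = 2 * cosh z * sinh (real (k + 1) * z) - sinh (real k * z)" for k
  proof -
    have "sinh (real (k + 2) * z) = sinh (real (k + 1) * z + z)" "sinh (real k * z) = sinh (real (k + 1) * z - z)"
      by (simp_all add: algebra_simps)
    then show ?thesis by (simp add: sinh_add sinh_diff)
  qed
  moreover have "2 * cosh z \<noteq> 2" using z by simp
  moreover have "sinh (real 1 * z) \<noteq> 0" using z by simp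
  moreover have "2 - 2 * cosh z = - 4 * s\<^sup>2" unfolding dbl py by simp
  moreover have "Re \<alpha> \<noteq> 1" using re by simp
  ultimately show ?thesis
    using lap_mat_root_if_closing[OF n, of "\<lambda>k. sinh (real k * z)" "2 * cosh z" \<alpha>]
    by (simp add: d)
qed

section \<open>Solutions of the closing equation\<close>

text \<open>Half of \<open>\<eta> + \<pi>\<close> on \<open>[0, \<pi>)\<close>. If \<open>z\<close> is the angle of an eigenvalue with even index, its phase is \<open>n z / 2\<close> reduced
modulo \<open>\<pi>\<close>.\<close>

definition phase :: "real \<Rightarrow> real \<Rightarrow> real" where
  "phase a x = arctan (kappa a * tan (x / 2))"

lemma kappa_gt_1: "a < 0 \<Longrightarrow> 1 < kappa a"
  by (simp add: kappa_def field_simps)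

lemma eta_eq_phase: "x \<noteq> pi \<Longrightarrow> eta a x = 2 * phase a x - pi"
  by (simp add: eta_def phase_def)

lemma cos_half_pos: "0 \<le> x \<Longrightarrow> x < pi \<Longrightarrow> 0 < cos (x / 2)" for x :: real
  by (intro cos_gt_zero_pi) auto

lemma phase_bounds:
  assumes "a < 0" "0 < x" "x < pi"
  shows "0 < phase a x" "phase a x < pi / 2"
proof -
  have "0 < tan (x / 2)" using assms by (intro tan_gt_zero) auto
  then show "0 < phase a x"
    using kappa_gt_1[OF assms(1)] by (simp add: phase_def)
  show "phase a x < pi / 2" unfolding phase_def by (rule arctan_ubound)
qed

lemma sin_phase:
  assumes "0 \<le> x" "x < pi"
  shows "sin (phase a x) * cos (x / 2) = kappa a * cos (phase a x) * sin (x / 2)"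
proof -
  have "cos (phase a x) \<noteq> 0" by (simp add: phase_def)
  moreover have "tan (phase a x) = kappa a * tan (x / 2)" by (simp add: phase_def tan_arctan)
  ultimately show ?thesis
    using cos_half_pos[OF assms] by (simp add: tan_def field_simps)
qed

lemma phase_closing:
  assumes "a < 0" "0 \<le> x" "x < pi"
  shows "(1 - a) * sin (x / 2) * cos (phase a x) + a * sin (phase a x) * cos (x / 2) = 0"
proof -
  have "a * kappa a = a - 1" using assms(1) by (simp add: kappa_def)
  then have "a * (kappa a * cos (phase a x) * sin (x / 2)) = (a - 1) * cos (phase a x) * sin (x / 2)"
    by (simp add: mult.assoc)
  then show ?thesis using sin_phase[OF assms(2,3), of a] by (simp add: algebra_simps)
qed

text \<open>The derivative is \<open>(\<kappa> / 2) / (cos\<^sup>2 (x / 2) + \<kappa>\<^sup>2 sin\<^sup>2 (x / 2))\<close>, whose denominator is at least 1 as \<open>\<kappa> > 1\<close>.\<close>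

lemma phase_has_derivative:
  assumes "a < 0" "0 \<le> x" "x < pi"
  shows "\<exists>D. (phase a has_real_derivative D) (at x) \<and> \<bar>D\<bar> \<le> kappa a / 2"
proof -
  let ?K = "kappa a" and ?c = "cos (x / 2)" and ?s = "sin (x / 2)"
  have K: "1 < ?K" by (rule kappa_gt_1[OF assms(1)])
  have c: "0 < ?c" by (rule cos_half_pos[OF assms(2,3)])
  let ?D = "?K / 2 / (?c\<^sup>2 + ?K\<^sup>2 * ?s\<^sup>2)"
  have "(phase a has_real_derivative
      inverse (1 + (?K * tan (x / 2))\<^sup>2) * (?K * (inverse (?c\<^sup>2) * (1 / 2)))) (at x)"
    unfolding phase_def using c by (auto intro!: derivative_eq_intros)
  moreover have "inverse (1 + (?K * tan (x / 2))\<^sup>2) * (?K * (inverse (?c\<^sup>2) * (1 / 2))) = ?D"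
    using c by (simp add: tan_def field_simps)
  moreover have "1 \<le> ?c\<^sup>2 + ?K\<^sup>2 * ?s\<^sup>2"
  proof -
    have "1 = ?c\<^sup>2 + 1 * ?s\<^sup>2" by simp
    also have "\<dots> \<le> ?c\<^sup>2 + ?K\<^sup>2 * ?s\<^sup>2"
      using K by (intro add_left_mono mult_right_mono) (auto simp: power2_eq_square intro: mult_ge1_I)
    finally show ?thesis .
  qed
  then have "?D \<le> ?K / 2 / 1" using K by (intro divide_left_mono) auto
  moreover have "0 \<le> ?D" using K by simp
  ultimately have "(phase a has_real_derivative ?D) (at x)" "\<bar>?D\<bar> \<le> ?K / 2" by (simp_all only: abs_of_nonneg div_by_1)
  then show ?thesis by blast
qed

lemma phase_Lipschitz:
  assumes "a < 0" "0 \<le> x" "x < pi" "0 \<le> y" "y < pi"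
  shows "\<bar>phase a x - phase a y\<bar> \<le> kappa a / 2 * \<bar>x - y\<bar>"
proof -
  obtain D where D: "\<And>t. 0 \<le> t \<Longrightarrow> t < pi \<Longrightarrow> (phase a has_real_derivative D t) (at t) \<and> \<bar>D t\<bar> \<le> kappa a / 2"
    using phase_has_derivative[OF assms(1)] by metis
  have ordered: "\<bar>phase a x - phase a y\<bar> \<le> kappa a / 2 * \<bar>x - y\<bar>"
    if xy: "x < y" "0 \<le> x" "y < pi" for x y
  proof -
    have "DERIV (phase a) t :> D t" if "x \<le> t" "t \<le> y" for t using D that xy by auto
    from MVT2[OF xy(1) this] obtain t where t: "x < t" "t < y" "phase a y - phase a x = (y - x) * D t"
      by blast
    then have "\<bar>phase a x - phase a y\<bar> = \<bar>D t\<bar> * \<bar>x - y\<bar>"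
      by (metis abs_minus_commute abs_mult mult.commute)
    also have "\<dots> \<le> kappa a / 2 * \<bar>x - y\<bar>" using D[of t] t xy by (intro mult_right_mono) auto
    finally show ?thesis .
  qed
  show ?thesis
    using ordered[of x y] ordered[of y x] assms by (cases x y rule: linorder_cases) (auto simp: abs_minus_commute)
qed

text \<open>The difference \<open>n z - (j - 1) \<pi> - \<eta>(z)\<close> is \<open>- (\<pi> + \<eta>) < 0\<close> at node \<open>j - 1\<close> and \<open>- \<eta> > 0\<close> at node \<open>j\<close>. The case
\<open>j = 2\<close> is different: there node \<open>j - 1\<close> is 0, where the difference vanishes.\<close>

lemma even_angle_exists:
  assumes a: "a < 0" and j: "even j" "4 \<le> j" "j \<le> n"
  shows "\<exists>z. node n (j - 1) < z \<and> z < node n j \<and> real n * z = (real j - 1) * pi + eta a z"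
proof -
  let ?l = "node n (j - 1)" and ?u = "node n j"
  define F where "F x = real n * x - 2 * phase a x - (real j - 2) * pi" for x
  have n: "0 < real n" using j by simp
  have l: "0 < ?l" "real n * ?l = (real j - 2) * pi" using j n by (auto simp: node_def of_nat_diff)
  have "(real j - 1) * pi < real n * pi" using j by (intro mult_strict_right_mono) auto
  then have u: "?u < pi" "real n * ?u = (real j - 1) * pi" using n by (auto simp: node_def field_simps)
  have "real n * ?l < real n * ?u" unfolding l u by (intro mult_strict_right_mono) auto
  then have lu: "?l < ?u" using n by simp
  have "F ?l < 0" using phase_bounds[OF a, of ?l] l u lu by (simp add: F_def)
  moreover have "0 < F ?u" using phase_bounds[OF a, of ?u] l u lu by (simp add: F_def algebra_simps)
  moreover have "continuous_on {?l..?u} F"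
  proof (intro continuous_at_imp_continuous_on ballI)
    fix x assume "x \<in> {?l..?u}"
    then have "isCont (phase a) x"
      using phase_has_derivative[OF a, of x] l u by (auto intro: DERIV_isCont)
    then show "isCont F x" unfolding F_def by (intro continuous_intros)
  qed
  ultimately obtain z where z: "?l \<le> z" "z \<le> ?u" "F z = 0"
    using IVT'[of F ?l 0 ?u] lu by force
  with \<open>F ?l < 0\<close> \<open>0 < F ?u\<close> have "?l < z" "z < ?u"
    by (metis less_irrefl order_le_imp_less_or_eq)+
  moreover have "real n * z = (real j - 1) * pi + eta a z"
    using z u by (subst eta_eq_phase) (auto simp: F_def algebra_simps)
  ultimately show ?thesis by blast
qed

lemma phase_of_even_angle:
  assumes j: "even j" "2 \<le> j" and z: "z \<noteq> pi" "real n * z = (real j - 1) * pi + eta a z"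
  shows "\<exists>\<epsilon>\<in>{1, - 1}. sin (real n * z / 2) = \<epsilon> * sin (phase a z) \<and> cos (real n * z / 2) = \<epsilon> * cos (phase a z)"
proof -
  obtain m where m: "j = 2 * m + 2" using j by (metis add.commute evenE le_Suc_ex even_add even_numeral)
  have e: "real n * z / 2 = phase a z + real m * pi"
    using z(2) unfolding eta_eq_phase[OF z(1)] m by (simp add: field_simps)
  have "sin (real n * z / 2) = (- 1) ^ m * sin (phase a z)" "cos (real n * z / 2) = (- 1) ^ m * cos (phase a z)"
    unfolding e sin_add cos_add by (simp_all add: mult.commute)
  moreover have "(- 1 :: real) ^ m \<in> {1, - 1}" using minus_one_power_iff[of m] by (auto split: if_splits)
  ultimately show ?thesis by blast
qed

text \<open>The difference \<open>\<kappa> tanh (s / 2) - tanh (n s / 2)\<close> is negative at \<open>s\<^sub>0\<close> and positive at \<open>ln (1 - 2 a)\<close>, where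
\<open>\<kappa> tanh (s / 2) = 1\<close>.\<close>

lemma hyperbolic_root_exists:
  assumes a: "a < 0" and s0: "0 < s0" and n: "kappa a * tanh (s0 / 2) < tanh (real n * s0 / 2)"
  shows "\<exists>s. s0 \<le> s \<and> s \<le> ln (1 - 2 * a) \<and>
    (1 - a) * sinh (s / 2) * cosh (real n * s / 2) + a * sinh (real n * s / 2) * cosh (s / 2) = 0"
proof -
  define F where "F s = kappa a * tanh (s / 2) - tanh (real n * s / 2)" for s
  define L where "L = ln (1 - 2 * a)"
  have K: "1 < kappa a" by (rule kappa_gt_1[OF a])
  have L2: "L / 2 = ln (sqrt (1 - 2 * a))" using a by (simp add: L_def ln_sqrt)
  have "tanh (L / 2) = ((1 - 2 * a) - 1) / ((1 - 2 * a) + 1)"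
    unfolding L2 using a by (subst tanh_ln_real) auto
  then have KL: "kappa a * tanh (L / 2) = 1" using a by (simp add: kappa_def field_simps)
  have "kappa a * tanh (s0 / 2) < kappa a * tanh (L / 2)"
    unfolding KL using n tanh_real_lt_1[of "real n * s0 / 2"] by linarith
  then have s0L: "s0 \<le> L" using K by simp
  have "F s0 \<le> 0" "0 \<le> F L"
    using n KL tanh_real_lt_1[of "real n * L / 2"] by (auto simp: F_def)
  moreover have "continuous_on {s0..L} F" unfolding F_def by (intro continuous_intros) auto
  ultimately obtain s where s: "s0 \<le> s" "s \<le> L" "F s = 0"
    using IVT'[of F s0 0 L] s0L by blast
  have "sinh (real n * s / 2) * cosh (s / 2) = kappa a * sinh (s / 2) * cosh (real n * s / 2)"
    using s(3) by (simp add: F_def tanh_def field_simps)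
  then have "a * (sinh (real n * s / 2) * cosh (s / 2)) = (a * kappa a) * (sinh (s / 2) * cosh (real n * s / 2))"
    by simp
  moreover have "a * kappa a = a - 1" using a by (simp add: kappa_def)
  ultimately have "(1 - a) * sinh (s / 2) * cosh (real n * s / 2) + a * sinh (real n * s / 2) * cosh (s / 2) = 0"
    by (simp add: algebra_simps)
  with s show ?thesis unfolding L_def by blast
qed

text \<open>A lower bound for the roots that works for all \<open>n\<close> at once: choose \<open>s\<^sub>0\<close> for the least admissible \<open>n\<close>, where
\<open>\<kappa> < n\<close> makes \<open>tanh (n s / 2)\<close> exceed \<open>\<kappa> tanh (s / 2)\<close> near 0, and note that \<open>tanh (n s\<^sub>0 / 2)\<close> increases with \<open>n\<close>.\<close>

lemma uniform_hyperbolic_roots: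
  assumes a: "a < 0"
  obtains s0 where "0 < s0" and "\<And>n. N_min a \<le> n \<Longrightarrow> \<exists>s. s0 \<le> s \<and> s \<le> ln (1 - 2 * a) \<and>
    (1 - a) * sinh (s / 2) * cosh (real n * s / 2) + a * sinh (real n * s / 2) * cosh (s / 2) = 0"
proof -
  let ?N = "real (N_min a)" and ?K = "kappa a"
  have "?K < ?N" unfolding N_min_def by linarith
  define G where "G x = tanh (?N * x / 2) - ?K * tanh (x / 2)" for x
  \<comment> \<open>\<open>G\<close> vanishes at 0 with positive slope, so it is positive just to the right of 0.\<close>
  have "(G has_real_derivative (?N - ?K) / 2) (at 0)"
    unfolding G_def by (auto intro!: derivative_eq_intros simp: field_simps)
  from DERIV_pos_inc_right[OF this] \<open>?K < ?N\<close>
  obtain d where d: "0 < d" "\<And>h. 0 < h \<Longrightarrow> h < d \<Longrightarrow> G 0 < G (0 + h)" by auto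
  define s0 where "s0 = d / 2"
  have s0: "0 < s0" "0 < G s0" using d(1) d(2)[of s0] by (auto simp: s0_def G_def)
  show thesis
  proof (rule that[OF s0(1)])
    fix n assume "N_min a \<le> n"
    then have "tanh (?N * s0 / 2) \<le> tanh (real n * s0 / 2)" using s0(1) by simp
    moreover have "?K * tanh (s0 / 2) < tanh (?N * s0 / 2)" using s0(2) by (simp add: G_def)
    ultimately have "?K * tanh (s0 / 2) < tanh (real n * s0 / 2)" by (rule less_le_trans[rotated])
    then show "\<exists>s. s0 \<le> s \<and> s \<le> ln (1 - 2 * a) \<and>
      (1 - a) * sinh (s / 2) * cosh (real n * s / 2) + a * sinh (real n * s / 2) * cosh (s / 2) = 0"
      by (rule hyperbolic_root_exists[OF a s0(1)])
  qed
qed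

section \<open>The ordered spectrum\<close>

text \<open>The angle \<open>z\<close> with \<open>g(z) = \<lambda>\<^sub>j\<close> for \<open>j \<ge> 2\<close>; index 2 belongs to the constant eigenvector.\<close>

definition lap_angle :: "real \<Rightarrow> nat \<Rightarrow> nat \<Rightarrow> real" where
  "lap_angle a n j =
     (if odd j then node n j else if j = 2 then 0
      else SOME z. node n (j - 1) < z \<and> z < node n j \<and> real n * z = (real j - 1) * pi + eta a z)"

lemma lap_angle_even:
  assumes "a < 0" "even j" "4 \<le> j" "j \<le> n"
  shows "node n (j - 1) < lap_angle a n j" "lap_angle a n j < node n j"
    "real n * lap_angle a n j = (real j - 1) * pi + eta a (lap_angle a n j)"
  using someI_ex[OF even_angle_exists[OF assms]] assms(2,3) unfolding lap_angle_def by auto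

lemma node_mono: "i < j \<Longrightarrow> 0 < n \<Longrightarrow> node n i < node n j"
  unfolding node_def by (intro divide_strict_right_mono mult_strict_right_mono) auto

lemma node_less_pi:
  assumes "1 \<le> j" "j \<le> n"
  shows "node n j < pi"
proof -
  have "(real j - 1) * pi < real n * pi" using assms by (intro mult_strict_right_mono) auto
  then show ?thesis using assms by (simp add: node_def field_simps)
qed

lemma lap_angle_le_node:
  assumes "a < 0" "2 \<le> j" "j \<le> n"
  shows "lap_angle a n j \<le> node n j"
proof -
  have "odd j \<or> j = 2 \<or> (even j \<and> 4 \<le> j)" using assms(2) by presburger
  then consider "odd j" | "j = 2" | "even j" "4 \<le> j" by blast
  then show ?thesis
    by cases (use lap_angle_even[OF assms(1) _ _ assms(3)] in \<open>auto simp: lap_angle_def[of a n j] lap_angle_def[of a n 2] node_def less_imp_le\<close>)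
qed

lemma node_less_lap_angle:
  assumes "a < 0" "3 \<le> j" "j \<le> n"
  shows "node n (j - 1) < lap_angle a n j"
proof (cases "odd j")
  case True
  then show ?thesis using node_mono[of "j - 1" j n] assms by (simp add: lap_angle_def)
next
  case False
  then have "4 \<le> j" using assms(2) by presburger
  then show ?thesis using lap_angle_even[OF assms(1) _ _ assms(3)] False by auto
qed

text \<open>Each angle with index \<open>j \<ge> 3\<close> lies in the half-open interval from node \<open>j - 1\<close> (excluded) to node \<open>j\<close>.\<close>

lemma lap_angle_strict_mono:
  assumes "a < 0" "2 \<le> i" "i < j" "j \<le> n"
  shows "lap_angle a n i < lap_angle a n j"
proof -
  have "lap_angle a n i \<le> node n i" using assms by (intro lap_angle_le_node) auto
  also have "\<dots> \<le> node n (j - 1)"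
  proof (cases "i = j - 1")
    case False
    then show ?thesis using assms by (intro less_imp_le[OF node_mono]) auto
  qed simp
  also have "\<dots> < lap_angle a n j" using assms by (intro node_less_lap_angle) auto
  finally show ?thesis .
qed

lemma lap_angle_range:
  assumes "a < 0" "2 \<le> j" "j \<le> n"
  shows "0 \<le> lap_angle a n j" "lap_angle a n j < pi"
proof -
  have "lap_angle a n 2 = 0" by (simp add: lap_angle_def)
  then show "0 \<le> lap_angle a n j"
    using lap_angle_strict_mono[OF assms(1), of 2 j n] assms by (cases "j = 2") auto
  show "lap_angle a n j < pi"
    using lap_angle_le_node[OF assms] node_less_pi[of j n] assms by auto
qed

lemma lap_angle_pos:
  assumes "a < 0" "3 \<le> j" "j \<le> n"
  shows "0 < lap_angle a n j"
  using lap_angle_strict_mono[OF assms(1), of 2 j n] assms by (simp add: lap_angle_def[of _ _ 2])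

lemma lap_angle_odd_sin:
  assumes "odd j" "0 < n"
  shows "sin (real n * lap_angle a n j / 2) = 0"
proof -
  obtain m where m: "j = 2 * m + 1" using assms(1) by (rule oddE)
  have "real n * lap_angle a n j / 2 = real m * pi"
    using assms by (simp add: lap_angle_def node_def m)
  then show ?thesis by simp
qed

text \<open>The closing equation is homogeneous in \<open>(sin \<phi>, cos \<phi>)\<close>, so the sign lost by reducing \<open>\<phi> = n z / 2\<close> modulo \<open>\<pi>\<close> is
harmless.\<close>

lemma lap_angle_even_closing:
  assumes a: "a < 0" and j: "even j" "4 \<le> j" "j \<le> n"
  defines "z \<equiv> lap_angle a n j"
  shows "(1 - a) * sin (z / 2) * cos (real n * z / 2) + a * sin (real n * z / 2) * cos (z / 2) = 0"
proof -
  have z: "0 \<le> z" "z < pi" using lap_angle_range[OF a, of j n] j by (auto simp: z_def)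
  obtain \<epsilon> where e: "sin (real n * z / 2) = \<epsilon> * sin (phase a z)" "cos (real n * z / 2) = \<epsilon> * cos (phase a z)"
  proof -
    have "2 \<le> j" "z \<noteq> pi" using j z by auto
    from phase_of_even_angle[OF j(1) this(1) this(2)[unfolded z_def] lap_angle_even(3)[OF a j]]
    show ?thesis using that unfolding z_def by blast
  qed
  have "\<epsilon> * ((1 - a) * sin (z / 2) * cos (phase a z) + a * sin (phase a z) * cos (z / 2)) = 0"
    using phase_closing[OF a z] by simp
  then show ?thesis unfolding e by (simp add: algebra_simps)
qed

text \<open>Any solution \<open>s\<close> of the hyperbolic closing equation will do: together with 0 and the angles it makes \<open>n\<close> distinct
characteristic roots, and hence is the only one.\<close>

lemma lap_eigval_eq:
  assumes n: "3 \<le> n" and re: "Re \<alpha> < 0" and s: "0 < s"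
    and closing: "(1 - Re \<alpha>) * sinh (s / 2) * cosh (real n * s / 2)
       + Re \<alpha> * sinh (real n * s / 2) * cosh (s / 2) = 0"
  shows "lap_eigval \<alpha> n 1 = - 4 * (sinh (s / 2))\<^sup>2"
    and "2 \<le> j \<Longrightarrow> j \<le> n \<Longrightarrow> lap_eigval \<alpha> n j = gfun (lap_angle (Re \<alpha>) n j)"
proof -
  let ?z = "lap_angle (Re \<alpha>) n"
  define lam where "lam j = (if j = 1 then - 4 * (sinh (s / 2))\<^sup>2 else gfun (?z j))" for j
  have "strict_mono_on {1..n} lam"
  proof (rule strict_mono_onI)
    fix i j assume ij: "i \<in> {1..n}" "j \<in> {1..n}" "i < j"
    show "lam i < lam j"
    proof (cases "i = 1")
      case True
      have "lam i < 0" using s True by (simp add: lam_def)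
      also have "0 \<le> lam j" using ij True by (simp add: lam_def gfun_def)
      finally show ?thesis .
    next
      case False
      then show ?thesis
        using ij lap_angle_strict_mono[OF re, of i j n] lap_angle_range[OF re, of i n] lap_angle_range[OF re, of j n]
        by (simp add: lam_def gfun_less_iff)
    qed
  qed
  moreover have "poly (char_poly (lap_mat \<alpha> n)) (of_real (lam j)) = 0" if j: "j \<in> {1..n}" for j
  proof -
    have "1 \<le> j" using j by simp
    then have "j = 1 \<or> j = 2 \<or> (3 \<le> j \<and> odd j) \<or> (4 \<le> j \<and> even j)" by presburger
    then consider "j = 1" | "j = 2" | "3 \<le> j" "odd j" | "4 \<le> j" "even j" by blast
    then show ?thesis
    proof cases
      case 1
      then show ?thesis using lap_mat_root_sinh[OF n re s closing] by (simp add: lam_def)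
    next
      case 2
      then show ?thesis using lap_mat_root_zero[OF n] by (simp add: lam_def lap_angle_def gfun_def)
    next
      case 3
      then show ?thesis
        using lap_mat_root_sine[OF n re lap_angle_pos[OF re] lap_angle_range(2)[OF re]] lap_angle_odd_sin[of j n "Re \<alpha>"] j
        by (simp add: lam_def)
    next
      case 4
      then show ?thesis
        using lap_mat_root_sine[OF n re lap_angle_pos[OF re] lap_angle_range(2)[OF re]] lap_angle_even_closing[OF re] j
        by (simp add: lam_def)
    qed
  qed
  ultimately have eq: "lap_eigval \<alpha> n j = lam j" if "j \<in> {1..n}" for j
    using that by (rule lap_eigval_eqI)
  show "lap_eigval \<alpha> n 1 = - 4 * (sinh (s / 2))\<^sup>2"
    using eq[of 1] n by (simp add: lam_def)
  show "lap_eigval \<alpha> n j = gfun (lap_angle (Re \<alpha>) n j)" if "2 \<le> j" "j \<le> n"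
    using eq[of j] that by (simp add: lam_def)
qed

lemma N_min_ge_3: "3 \<le> N_min a"
  unfolding N_min_def by linarith

lemma lap_eigval_eq_gfun_lap_angle:
  assumes re: "Re \<alpha> < 0" and "N_min (Re \<alpha>) \<le> n" "2 \<le> j" "j \<le> n"
  shows "lap_eigval \<alpha> n j = gfun (lap_angle (Re \<alpha>) n j)"
proof -
  obtain s0 where s0: "0 < s0" "\<And>n. N_min (Re \<alpha>) \<le> n \<Longrightarrow> \<exists>s. s0 \<le> s \<and> s \<le> ln (1 - 2 * Re \<alpha>) \<and>
      (1 - Re \<alpha>) * sinh (s / 2) * cosh (real n * s / 2) + Re \<alpha> * sinh (real n * s / 2) * cosh (s / 2) = 0"
    using uniform_hyperbolic_roots[OF re] by blast
  obtain s where s: "s0 \<le> s"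
      "(1 - Re \<alpha>) * sinh (s / 2) * cosh (real n * s / 2) + Re \<alpha> * sinh (real n * s / 2) * cosh (s / 2) = 0"
    using s0(2)[OF assms(2)] by blast
  have "3 \<le> n" "0 < s" using N_min_ge_3[of "Re \<alpha>"] assms(2) s0(1) s(1) by auto
  then show ?thesis using lap_eigval_eq(2)[OF _ re _ s(2)] assms(3,4) by blast
qed

lemma zeta_eq_lap_angle:
  assumes "Re \<alpha> < 0" "2 \<le> j" "j \<le> n" and "lap_eigval \<alpha> n j = gfun (lap_angle (Re \<alpha>) n j)"
  shows "zeta \<alpha> n j = lap_angle (Re \<alpha>) n j"
  unfolding zeta_def assms(4)
proof (rule the_equality)
  show "0 \<le> lap_angle (Re \<alpha>) n j \<and> lap_angle (Re \<alpha>) n j \<le> pi \<and> gfun (lap_angle (Re \<alpha>) n j) = gfun (lap_angle (Re \<alpha>) n j)"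
    using lap_angle_range[OF assms(1-3)] by simp
  fix z assume "0 \<le> z \<and> z \<le> pi \<and> gfun z = gfun (lap_angle (Re \<alpha>) n j)"
  then show "z = lap_angle (Re \<alpha>) n j"
    using lap_angle_range[OF assms(1-3)] gfun_less_iff[of z "lap_angle (Re \<alpha>) n j"] gfun_less_iff[of "lap_angle (Re \<alpha>) n j" z]
    by (cases z "lap_angle (Re \<alpha>) n j" rule: linorder_cases) auto
qed

lemma sparam_eq:
  assumes "0 < s" "lap_eigval \<alpha> n 1 = - 4 * (sinh (s / 2))\<^sup>2"
  shows "sparam \<alpha> n = s"
  unfolding sparam_def assms(2)
proof (rule the_equality)
  show "0 < s \<and> - 4 * (sinh (s / 2))\<^sup>2 = - 4 * (sinh (s / 2))\<^sup>2" using assms(1) by simp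
  fix t :: real assume t: "0 < t \<and> - 4 * (sinh (t / 2))\<^sup>2 = - 4 * (sinh (s / 2))\<^sup>2"
  then have "(sinh (t / 2))\<^sup>2 = (sinh (s / 2))\<^sup>2" "0 \<le> sinh (t / 2)" "0 \<le> sinh (s / 2)"
    using assms(1) by simp_all
  then have "sinh (t / 2) = sinh (s / 2)" by (rule power2_eq_imp_eq)
  then show "t = s" by simp
qed

section \<open>Norms of the oscillating eigenvectors\<close>

text \<open>Telescoping sum: the right-hand side grows by \<open>sin z cos ((2 n + 1) z - \<psi>)\<close> when \<open>n\<close> grows by one.\<close>

lemma sum_cos_odd_multiples:
  fixes z \<psi> :: real
  shows "sin z * (\<Sum>k=1..n. cos ((2 * real k - 1) * z - \<psi>)) = sin (real n * z) * cos (real n * z - \<psi>)"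
proof (induction n)
  case (Suc n)
  have "sin z * (\<Sum>k=1..Suc n. cos ((2 * real k - 1) * z - \<psi>))
      = sin (real n * z) * cos (real n * z - \<psi>) + sin z * cos ((2 * real n + 1) * z - \<psi>)"
    using Suc by (simp add: distrib_left algebra_simps)
  also have "\<dots> = (sin (2 * (real n * z) - \<psi>) + sin \<psi>) / 2
      + (sin ((2 * real n + 2) * z - \<psi>) + sin (\<psi> - 2 * (real n * z))) / 2"
    unfolding sin_times_cos by (simp add: algebra_simps)
  also have "\<dots> = (sin ((2 * real n + 2) * z - \<psi>) + sin \<psi>) / 2"
    using sin_minus[of "2 * (real n * z) - \<psi>"] by (simp add: add_divide_distrib diff_divide_distrib)
  also have "\<dots> = sin (real (Suc n) * z) * cos (real (Suc n) * z - \<psi>)"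
    unfolding sin_times_cos by (simp add: algebra_simps)
  finally show ?case .
qed simp

definition sine_vec :: "complex \<Rightarrow> nat \<Rightarrow> real \<Rightarrow> nat \<Rightarrow> complex" where
  "sine_vec \<alpha> n z k = of_real (sin (real k * z))
     - (1 - cnj \<alpha>) * of_real (sin ((real k - 1) * z))
     + cnj \<alpha> * of_real (sin ((real n - real k) * z))"

lemma sine_differences:
  fixes z :: real
  shows "sin (real k * z) - sin ((real k - 1) * z) = 2 * sin (z / 2) * cos ((2 * real k - 1) * z / 2)"
    and "sin ((real k - 1) * z) + sin ((real n - real k) * z)
         = 2 * sin (real n * z / 2 - z / 2) * cos ((2 * real k - 1) * z / 2 - real n * z / 2)"
proof -
  have "(real k * z - (real k - 1) * z) / 2 = z / 2" "(real k * z + (real k - 1) * z) / 2 = (2 * real k - 1) * z / 2"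
    by (simp_all add: algebra_simps)
  then show "sin (real k * z) - sin ((real k - 1) * z) = 2 * sin (z / 2) * cos ((2 * real k - 1) * z / 2)"
    unfolding sin_diff_sin by metis
  have "((real k - 1) * z + (real n - real k) * z) / 2 = real n * z / 2 - z / 2"
       "((real k - 1) * z - (real n - real k) * z) / 2 = (2 * real k - 1) * z / 2 - real n * z / 2"
    by (simp_all add: field_simps)
  then show "sin ((real k - 1) * z) + sin ((real n - real k) * z)
         = 2 * sin (real n * z / 2 - z / 2) * cos ((2 * real k - 1) * z / 2 - real n * z / 2)"
    unfolding sin_plus_sin by metis
qed

lemma sine_vec_split:
  "sine_vec \<alpha> n z k = of_real (2 * sin (z / 2) * cos ((2 * real k - 1) * z / 2))
     + cnj \<alpha> * of_real (2 * sin (real n * z / 2 - z / 2) * cos ((2 * real k - 1) * z / 2 - real n * z / 2))"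
  unfolding sine_differences[symmetric] sine_vec_def by (simp add: algebra_simps)

lemma eigvec_norm_eq_sine_vec:
  assumes "j \<noteq> 1"
  shows "eigvec_norm \<alpha> n j = sqrt (\<Sum>k=1..n. (cmod (sine_vec \<alpha> n (zeta \<alpha> n j) k))\<^sup>2)"
  using assms by (simp add: eigvec_norm_def L2_set_def eigvec_def sine_vec_def)

text \<open>If \<open>n z\<close> is a multiple of \<open>2 \<pi>\<close>, then \<open>sin ((n - k) z) = - sin (k z)\<close>, and the vector is \<open>1 - cnj \<alpha>\<close> times the differences
of consecutive sines. Their squares average to \<open>2 sin\<^sup>2 (z / 2)\<close>, as the cosines sum to 0.\<close>

lemma norm_sine_vec_periodic:
  fixes z :: real
  assumes "sin (real n * z / 2) = 0" and "sin z \<noteq> 0"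
  shows "(\<Sum>k=1..n. (cmod (sine_vec \<alpha> n z k))\<^sup>2) = (cmod (1 - \<alpha>))\<^sup>2 * (real n / 2 * gfun z)"
proof -
  have cos2: "(cos (real n * z / 2))\<^sup>2 = 1"
    using assms(1) sin_cos_squared_add[of "real n * z / 2"] by simp
  have "sine_vec \<alpha> n z k = (1 - cnj \<alpha>) * of_real (2 * sin (z / 2) * cos ((2 * real k - 1) * z / 2))" for k
  proof -
    have "sin (real n * z / 2 - z / 2) * cos ((2 * real k - 1) * z / 2 - real n * z / 2)
        = - (cos (real n * z / 2))\<^sup>2 * sin (z / 2) * cos ((2 * real k - 1) * z / 2)"
      unfolding sin_diff cos_diff assms(1) by (simp add: power2_eq_square)
    then show ?thesis unfolding sine_vec_split cos2 by (simp add: algebra_simps)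
  qed
  then have "(cmod (sine_vec \<alpha> n z k))\<^sup>2
      = (cmod (1 - \<alpha>))\<^sup>2 * (2 * (sin (z / 2))\<^sup>2 * (1 + cos ((2 * real k - 1) * z - 0)))" for k
    using cos_double_cos[of "(2 * real k - 1) * z / 2"] complex_mod_cnj[of "1 - \<alpha>"]
    by (simp add: norm_mult power_mult_distrib)
  moreover have "(\<Sum>k=1..n. cos ((2 * real k - 1) * z - 0)) = 0"
  proof -
    have "sin (real n * z) = 0" using assms(1) sin_double[of "real n * z / 2"] by simp
    then show ?thesis using sum_cos_odd_multiples[of z 0 n] assms(2) by simp
  qed
  ultimately show ?thesis
    by (simp add: sum.distrib gfun_def flip: sum_distrib_left)
qed

lemma eigvec_norm_odd:
  assumes re: "Re \<alpha> < 0" and j: "odd j" "3 \<le> j" "j \<le> n"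
    and ev: "lap_eigval \<alpha> n j = gfun (lap_angle (Re \<alpha>) n j)"
  shows "eigvec_norm \<alpha> n j = cmod (1 - \<alpha>) * sqrt (real n / 2 * lap_eigval \<alpha> n j)"
proof -
  define z where "z = lap_angle (Re \<alpha>) n j"
  have z: "0 < z" "z < pi" using lap_angle_pos[OF re, of j n] lap_angle_range[OF re, of j n] j by (auto simp: z_def)
  have "zeta \<alpha> n j = z" using zeta_eq_lap_angle[OF re _ _ ev] j by (simp add: z_def)
  moreover have "sin (real n * z / 2) = 0" using lap_angle_odd_sin j by (simp add: z_def)
  moreover have "sin z \<noteq> 0" using sin_gt_zero[OF z] by simp
  ultimately have "eigvec_norm \<alpha> n j = sqrt ((cmod (1 - \<alpha>))\<^sup>2 * (real n / 2 * gfun z))"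
    using norm_sine_vec_periodic[of n z \<alpha>] eigvec_norm_eq_sine_vec[of j \<alpha> n] j by auto
  then show ?thesis unfolding ev z_def[symmetric] real_sqrt_mult[of "(cmod (1 - \<alpha>))\<^sup>2"] by simp
qed

text \<open>The closing equation turns \<open>a sin (\<phi> - h)\<close> into \<open>- sin h cos \<phi>\<close>; the addition theorem for
\<open>\<theta> = (\<theta> - \<phi>) + \<phi>\<close> then cancels the term \<open>cos \<phi> cos (\<theta> - \<phi>)\<close> in the real part.\<close>

lemma sine_vec_closed_form:
  fixes z :: real and n :: nat
  defines "h \<equiv> z / 2" and "\<phi> \<equiv> real n * z / 2"
  assumes a: "Re \<alpha> \<noteq> 0"
    and closing: "(1 - Re \<alpha>) * sin h * cos \<phi> + Re \<alpha> * sin \<phi> * cos h = 0"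
  shows "sine_vec \<alpha> n z k = Complex (- (2 * sin h * sin \<phi> * sin ((2 * real k - 1) * h - \<phi>)))
           (2 * (Im \<alpha> / Re \<alpha>) * sin h * cos \<phi> * cos ((2 * real k - 1) * h - \<phi>))"
proof -
  define \<theta> where "\<theta> = (2 * real k - 1) * h"
  have *: "Re \<alpha> * sin (\<phi> - h) = - (sin h * cos \<phi>)"
    using closing by (simp add: sin_diff algebra_simps)
  then have **: "sin (\<phi> - h) = - (sin h * cos \<phi>) / Re \<alpha>"
    using a by (simp add: field_simps)
  have v: "sine_vec \<alpha> n z k = of_real (2 * sin h * cos \<theta>) + cnj \<alpha> * of_real (2 * sin (\<phi> - h) * cos (\<theta> - \<phi>))"
    unfolding sine_vec_split \<theta>_def h_def \<phi>_def by simp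
  have "Re (sine_vec \<alpha> n z k) = 2 * sin h * cos \<theta> + 2 * (Re \<alpha> * sin (\<phi> - h)) * cos (\<theta> - \<phi>)"
    unfolding v by simp
  also have "\<dots> = 2 * sin h * (cos ((\<theta> - \<phi>) + \<phi>) - cos \<phi> * cos (\<theta> - \<phi>))"
    unfolding * by (simp add: algebra_simps)
  also have "\<dots> = - (2 * sin h * sin \<phi> * sin (\<theta> - \<phi>))"
    unfolding cos_add by (simp add: algebra_simps)
  finally have "Re (sine_vec \<alpha> n z k) = - (2 * sin h * sin \<phi> * sin (\<theta> - \<phi>))" .
  moreover have "Im (sine_vec \<alpha> n z k) = 2 * (Im \<alpha> / Re \<alpha>) * sin h * cos \<phi> * cos (\<theta> - \<phi>)"
    unfolding v ** by simp
  ultimately show ?thesis unfolding complex_eq_iff \<theta>_def by simp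
qed

lemma norm_sine_vec_closed_form:
  fixes z :: real and n :: nat
  defines "h \<equiv> z / 2" and "\<phi> \<equiv> real n * z / 2" and "M \<equiv> sin (real n * z) / sin z"
  assumes a: "Re \<alpha> \<noteq> 0" and z: "sin z \<noteq> 0"
    and closing: "(1 - Re \<alpha>) * sin h * cos \<phi> + Re \<alpha> * sin \<phi> * cos h = 0"
  shows "(\<Sum>k=1..n. (cmod (sine_vec \<alpha> n z k))\<^sup>2)
    = 2 * (sin h)\<^sup>2 * ((sin \<phi>)\<^sup>2 * (real n - M) + (Im \<alpha> / Re \<alpha>)\<^sup>2 * (cos \<phi>)\<^sup>2 * (real n + M))"
proof -
  define c where "c k = cos ((2 * real k - 1) * z - real n * z)" for k
  have M: "(\<Sum>k=1..n. c k) = M"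
    using sum_cos_odd_multiples[of z "real n * z" n] z by (simp add: c_def M_def field_simps)
  have sq: "2 * (sin ((2 * real k - 1) * h - \<phi>))\<^sup>2 = 1 - c k"
      "2 * (cos ((2 * real k - 1) * h - \<phi>))\<^sup>2 = 1 + c k" for k
    using cos_double_sin[of "(2 * real k - 1) * h - \<phi>"] cos_double_cos[of "(2 * real k - 1) * h - \<phi>"]
    by (simp_all add: c_def h_def \<phi>_def algebra_simps)
  have id: "(- (2 * p * q * u))\<^sup>2 + (2 * b * p * r * w)\<^sup>2
      = 2 * p\<^sup>2 * (q\<^sup>2 * (2 * u\<^sup>2) + b\<^sup>2 * r\<^sup>2 * (2 * w\<^sup>2))" for p q r u w b :: real
    by (simp add: power2_eq_square algebra_simps)
  have "(cmod (sine_vec \<alpha> n z k))\<^sup>2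
      = 2 * (sin h)\<^sup>2 * ((sin \<phi>)\<^sup>2 * (1 - c k) + (Im \<alpha> / Re \<alpha>)\<^sup>2 * (cos \<phi>)\<^sup>2 * (1 + c k))" for k
    unfolding sine_vec_closed_form[OF a closing[unfolded h_def \<phi>_def], folded h_def \<phi>_def]
      cmod_power2 sq[symmetric] complex.sel by (rule id)
  then show ?thesis
    using M by (simp add: sum.distrib sum_subtractf flip: sum_distrib_left)
qed

text \<open>The defining formula of \<open>\<nu>\<close> hides its size: for \<open>h = x / 2\<close> and \<open>\<phi>\<close> the phase, \<open>g(\<eta>(x)) = 4 cos\<^sup>2 \<phi>\<close> and
\<open>g(x - \<eta>(x)) = 4 cos\<^sup>2 (\<phi> - h)\<close>, and the closing equation for \<open>\<phi>\<close> brings the sum to this manifestly nonnegative form.\<close>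

lemma nu_eq:
  assumes a: "Re \<alpha> < 0" and x: "0 \<le> x" "x < pi"
  shows "nu \<alpha> x = 2 * (sin (x / 2))\<^sup>2 *
     ((sin (phase (Re \<alpha>) x))\<^sup>2 + (Im \<alpha> / Re \<alpha>)\<^sup>2 * (cos (phase (Re \<alpha>) x))\<^sup>2)"
proof -
  define a h \<phi> where "a = Re \<alpha>" "h = x / 2" "\<phi> = phase a x"
  define S C s c where "S = sin \<phi>" "C = cos \<phi>" "s = sin h" "c = cos h"
  note d = a_h_\<phi>_def S_C_s_c_def
  have a0: "a \<noteq> 0" using a d by simp
  have py: "S\<^sup>2 = 1 - C\<^sup>2" "c\<^sup>2 = 1 - s\<^sup>2"
    unfolding d by (rule sin_squared_eq, rule cos_squared_eq)
  have cl: "a * (S * c - C * s) = - (s * C)"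
    using phase_closing[OF a x] by (simp add: d algebra_simps)
  have eta: "eta a x = 2 * \<phi> - pi" using x by (simp add: eta_eq_phase d)
  have "gfun (eta a x) = 4 * C\<^sup>2"
    unfolding gfun_def eta by (simp add: diff_divide_distrib sin_diff d)
  moreover have "gfun (x - eta a x) = 4 * (C * c + S * s)\<^sup>2"
  proof -
    have "(x - eta a x) / 2 = pi / 2 - (\<phi> - h)" unfolding eta a_h_\<phi>_def(2) by (simp add: field_simps)
    then have "sin ((x - eta a x) / 2) = cos (\<phi> - h)" by (simp only: sin_diff[of "pi / 2"]) simp
    then show ?thesis by (simp add: gfun_def cos_diff d)
  qed
  moreover have "gfun x = 4 * s\<^sup>2" by (simp add: gfun_def d)
  moreover have "(cmod \<alpha>)\<^sup>2 = a\<^sup>2 + (Im \<alpha>)\<^sup>2" by (simp add: cmod_power2 d)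
  ultimately have "nu \<alpha> x = 2 * (1 - a) * s\<^sup>2 - 2 * a * C\<^sup>2 + 2 * a * (C * c + S * s)\<^sup>2
      + 2 * (a\<^sup>2 + (Im \<alpha>)\<^sup>2) * (1 - (C * c + S * s)\<^sup>2)"
    unfolding nu_def a_h_\<phi>_def(1)[symmetric] by (simp add: algebra_simps diff_divide_distrib add_divide_distrib)
  also have "1 - (C * c + S * s)\<^sup>2 = (S * c - C * s)\<^sup>2"
    unfolding power2_sum power2_diff power_mult_distrib py by (simp add: algebra_simps)
  also have "2 * (1 - a) * s\<^sup>2 - 2 * a * C\<^sup>2 + 2 * a * (C * c + S * s)\<^sup>2
      = 2 * s\<^sup>2 + 4 * (a * (S * c - C * s)) * s * C"
    unfolding power2_sum power_mult_distrib py by (simp add: power2_eq_square algebra_simps)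
  also have "2 * (a\<^sup>2 + (Im \<alpha>)\<^sup>2) * (S * c - C * s)\<^sup>2
      = 2 * ((1 + (Im \<alpha> / a)\<^sup>2) * (a * (S * c - C * s))\<^sup>2)"
    using a0 by (simp add: power_mult_distrib power_divide distrib_right)
  finally have "nu \<alpha> x = 2 * s\<^sup>2 * ((1 - C\<^sup>2) + (Im \<alpha> / a)\<^sup>2 * C\<^sup>2)"
    unfolding cl by (simp add: power2_eq_square algebra_simps)
  then show ?thesis unfolding py(1)[symmetric] by (simp add: d)
qed

text \<open>Up to \<open>\<surd>2\<close>, \<open>\<surd>\<nu>\<close> is the product of \<open>sin (x / 2)\<close> and the length of the vector
\<open>(sin \<phi>, b cos \<phi>)\<close>, where \<open>b = Im \<alpha> / Re \<alpha>\<close> and \<open>\<phi>\<close> is the phase. Both factors are bounded and Lipschitz in \<open>x\<close>,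
also where \<open>\<nu>\<close> has a zero.\<close>

lemma sqrt_nu_Lipschitz:
  assumes a: "Re \<alpha> < 0" and xy: "0 \<le> x" "x < pi" "0 \<le> y" "y < pi"
  shows "\<bar>sqrt (nu \<alpha> x) - sqrt (nu \<alpha> y)\<bar>
    \<le> sqrt 2 * (1 + \<bar>Im \<alpha> / Re \<alpha>\<bar>) * (1 + kappa (Re \<alpha>)) * \<bar>x - y\<bar>"
proof -
  define b K where "b = Im \<alpha> / Re \<alpha>" "K = kappa (Re \<alpha>)"
  define P where "P t = Complex (sin t) (b * cos t)" for t
  define \<phi> where "\<phi> = phase (Re \<alpha>)"
  have K: "1 < K" using kappa_gt_1[OF a] by (simp add: b_K_def)
  have sq: "sqrt (nu \<alpha> t) = sqrt 2 * sin (t / 2) * cmod (P (\<phi> t))" if "0 \<le> t" "t < pi" for t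
  proof -
    have "0 \<le> sin (t / 2)" using that by (intro sin_ge_zero) auto
    then show ?thesis unfolding nu_eq[OF a that]
      by (simp add: real_sqrt_mult P_def cmod_def \<phi>_def b_K_def power_mult_distrib power_divide)
  qed
  have P1: "cmod (P t) \<le> 1 + \<bar>b\<bar>" for t
  proof -
    have "cmod (P t) \<le> \<bar>sin t\<bar> + \<bar>b * cos t\<bar>" using cmod_le[of "P t"] by (simp add: P_def)
    also have "\<dots> \<le> 1 + \<bar>b\<bar> * 1" unfolding abs_mult by (intro add_mono mult_left_mono) auto
    finally show ?thesis by simp
  qed
  have half: "\<bar>2 * sin ((t - u) / 2)\<bar> \<le> \<bar>t - u\<bar>" for t u :: real
    using abs_sin_x_le_abs_x[of "(t - u) / 2"] by simp
  have lip: "\<bar>sin t - sin u\<bar> \<le> \<bar>t - u\<bar>" "\<bar>cos t - cos u\<bar> \<le> \<bar>t - u\<bar>" for t u :: real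
  proof -
    have "\<bar>sin t - sin u\<bar> = \<bar>2 * sin ((t - u) / 2)\<bar> * \<bar>cos ((t + u) / 2)\<bar>"
      unfolding sin_diff_sin by (simp add: abs_mult)
    also have "\<dots> \<le> \<bar>t - u\<bar> * 1" by (intro mult_mono half) auto
    finally show "\<bar>sin t - sin u\<bar> \<le> \<bar>t - u\<bar>" by simp
    have "\<bar>cos t - cos u\<bar> = \<bar>2 * sin ((u - t) / 2)\<bar> * \<bar>sin ((t + u) / 2)\<bar>"
      unfolding cos_diff_cos by (simp add: abs_mult)
    also have "\<dots> \<le> \<bar>u - t\<bar> * 1" by (intro mult_mono half) auto
    finally show "\<bar>cos t - cos u\<bar> \<le> \<bar>t - u\<bar>" by simp
  qed
  have P2: "\<bar>cmod (P t) - cmod (P u)\<bar> \<le> (1 + \<bar>b\<bar>) * \<bar>t - u\<bar>" for t u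
  proof -
    have "\<bar>cmod (P t) - cmod (P u)\<bar> \<le> cmod (P t - P u)" by (rule norm_triangle_ineq3)
    also have "\<dots> \<le> \<bar>sin t - sin u\<bar> + \<bar>b\<bar> * \<bar>cos t - cos u\<bar>"
      using cmod_le[of "P t - P u"] by (simp add: P_def flip: abs_mult right_diff_distrib)
    also have "\<dots> \<le> \<bar>t - u\<bar> + \<bar>b\<bar> * \<bar>t - u\<bar>" by (intro add_mono mult_left_mono lip) auto
    finally show ?thesis by (simp add: algebra_simps)
  qed
  have "\<bar>sin (x / 2) * cmod (P (\<phi> x)) - sin (y / 2) * cmod (P (\<phi> y))\<bar>
    = \<bar>sin (x / 2) * (cmod (P (\<phi> x)) - cmod (P (\<phi> y))) + (sin (x / 2) - sin (y / 2)) * cmod (P (\<phi> y))\<bar>"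
    by (simp add: algebra_simps)
  also have "\<dots> \<le> \<bar>sin (x / 2)\<bar> * \<bar>cmod (P (\<phi> x)) - cmod (P (\<phi> y))\<bar>
      + \<bar>sin (x / 2) - sin (y / 2)\<bar> * cmod (P (\<phi> y))"
    by (rule order_trans[OF abs_triangle_ineq]) (simp add: abs_mult)
  also have "\<dots> \<le> 1 * ((1 + \<bar>b\<bar>) * (K / 2 * \<bar>x - y\<bar>)) + \<bar>x - y\<bar> * (1 + \<bar>b\<bar>)"
  proof (intro add_mono mult_mono P1)
    have "\<bar>\<phi> x - \<phi> y\<bar> \<le> K / 2 * \<bar>x - y\<bar>"
      unfolding \<phi>_def b_K_def by (rule phase_Lipschitz[OF a xy])
    then have "(1 + \<bar>b\<bar>) * \<bar>\<phi> x - \<phi> y\<bar> \<le> (1 + \<bar>b\<bar>) * (K / 2 * \<bar>x - y\<bar>)"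
      by (intro mult_left_mono) auto
    then show "\<bar>cmod (P (\<phi> x)) - cmod (P (\<phi> y))\<bar> \<le> (1 + \<bar>b\<bar>) * (K / 2 * \<bar>x - y\<bar>)"
      using P2 order_trans by blast
    show "\<bar>sin (x / 2) - sin (y / 2)\<bar> \<le> \<bar>x - y\<bar>"
      using lip(1)[of "x / 2" "y / 2"] by linarith
  qed auto
  also have "\<dots> \<le> (1 + \<bar>b\<bar>) * (1 + K) * \<bar>x - y\<bar>"
  proof -
    have "(1 + \<bar>b\<bar>) * \<bar>x - y\<bar> * (K / 2) \<le> (1 + \<bar>b\<bar>) * \<bar>x - y\<bar> * K"
      using K by (intro mult_left_mono) auto
    then show ?thesis by (simp add: algebra_simps)
  qed
  finally have "sqrt 2 * \<bar>sin (x / 2) * cmod (P (\<phi> x)) - sin (y / 2) * cmod (P (\<phi> y))\<bar>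
     \<le> sqrt 2 * ((1 + \<bar>b\<bar>) * (1 + K) * \<bar>x - y\<bar>)"
    by (intro mult_left_mono) auto
  moreover have "\<bar>sqrt (nu \<alpha> x) - sqrt (nu \<alpha> y)\<bar>
     = sqrt 2 * \<bar>sin (x / 2) * cmod (P (\<phi> x)) - sin (y / 2) * cmod (P (\<phi> y))\<bar>"
  proof -
    have "sqrt (nu \<alpha> x) - sqrt (nu \<alpha> y)
      = sqrt 2 * (sin (x / 2) * cmod (P (\<phi> x)) - sin (y / 2) * cmod (P (\<phi> y)))"
      unfolding sq[OF xy(1,2)] sq[OF xy(3,4)] by (simp add: algebra_simps)
    then show ?thesis by (simp add: abs_mult)
  qed
  ultimately show ?thesis by (simp add: b_K_def mult.assoc)
qed

text \<open>The phase is at least \<open>x / 2\<close>, because its tangent is \<open>\<kappa> > 1\<close> times that of \<open>x / 2\<close>.\<close>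

lemma cos_phase_sq_le:
  assumes "a < 0" "0 \<le> x" "x < pi"
  shows "(cos (phase a x))\<^sup>2 \<le> (cos (x / 2))\<^sup>2"
proof -
  define S C s c where "S = sin (phase a x)" "C = cos (phase a x)" "s = sin (x / 2)" "c = cos (x / 2)"
  note d = S_C_s_c_def
  have K: "1 \<le> (kappa a)\<^sup>2" using kappa_gt_1[OF assms(1)] by simp
  have py: "S\<^sup>2 = 1 - C\<^sup>2" "s\<^sup>2 + c\<^sup>2 = 1" by (simp_all add: d sin_squared_eq)
  have "(S * c)\<^sup>2 = (kappa a * C * s)\<^sup>2" using sin_phase[OF assms(2,3), of a] by (simp add: d)
  then have "c\<^sup>2 = C\<^sup>2 * (c\<^sup>2 + (kappa a)\<^sup>2 * s\<^sup>2)"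
    unfolding power_mult_distrib py by (simp add: algebra_simps)
  moreover have "C\<^sup>2 * (c\<^sup>2 + 1 * s\<^sup>2) \<le> C\<^sup>2 * (c\<^sup>2 + (kappa a)\<^sup>2 * s\<^sup>2)"
    using K by (intro mult_left_mono add_left_mono mult_right_mono) auto
  moreover have "c\<^sup>2 + 1 * s\<^sup>2 = 1" using py by simp
  ultimately show ?thesis by (simp add: d)
qed

text \<open>In the closed form of the norm the correction \<open>M = sin (n z) / sin z\<close> equals
\<open>\<kappa> cos\<^sup>2 \<phi> / cos\<^sup>2 h\<close>, which lies between 0 and \<open>\<kappa>\<close>.\<close>

lemma norm_sine_vec_approx_nu:
  assumes re: "Re \<alpha> < 0" and j: "even j" "4 \<le> j" "j \<le> n"
  defines "z \<equiv> lap_angle (Re \<alpha>) n j"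
  shows "\<bar>(\<Sum>k=1..n. (cmod (sine_vec \<alpha> n z k))\<^sup>2) - real n * nu \<alpha> z\<bar> \<le> kappa (Re \<alpha>) * nu \<alpha> z"
proof -
  define a K where "a = Re \<alpha>" "K = kappa a"
  have z: "0 < z" "z < pi" using lap_angle_pos[OF re, of j n] lap_angle_range[OF re, of j n] j by (auto simp: z_def)
  obtain \<epsilon> where e: "\<epsilon> \<in> {1, - 1}" "sin (real n * z / 2) = \<epsilon> * sin (phase a z)" "cos (real n * z / 2) = \<epsilon> * cos (phase a z)"
  proof -
    have "2 \<le> j" "z \<noteq> pi" using j z by auto
    from phase_of_even_angle[OF j(1) this(1) this(2)[unfolded z_def] lap_angle_even(3)[OF re j]]
    show ?thesis using that unfolding z_def a_K_def by blast
  qed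
  define S C s c b where "S = sin (phase a z)" "C = cos (phase a z)" "s = sin (z / 2)" "c = cos (z / 2)" "b = Im \<alpha> / Re \<alpha>"
  note d = S_C_s_c_b_def
  have e2: "\<epsilon>\<^sup>2 = 1" using e(1) by auto
  have K: "1 < K" using kappa_gt_1[OF re] by (simp add: a_K_def)
  have s: "0 < s" unfolding d using z by (intro sin_gt_zero) auto
  have c: "0 < c" unfolding d using z by (intro cos_half_pos) auto
  have Sc: "S * c = K * C * s" using sin_phase[of z a] z by (simp add: d a_K_def)
  define M where "M = sin (real n * z) / sin z"
  \<comment> \<open>\<open>n z / 2\<close> and the phase have sines and cosines that agree up to a common sign.\<close>
  have "sin (real n * z) = 2 * S * C"
    using sin_double[of "real n * z / 2"] e e2 by (simp add: d power2_eq_square)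
  moreover have sinz: "sin z = 2 * s * c" using sin_double[of "z / 2"] by (simp add: d)
  ultimately have "M = S * C / (s * c)" using s c by (simp add: M_def)
  also have "\<dots> = (S * c) * C / (s * c\<^sup>2)" using c by (simp add: power2_eq_square)
  also have "\<dots> = K * (C\<^sup>2 / c\<^sup>2)" unfolding Sc using s c by (simp add: power2_eq_square)
  finally have M: "M = K * (C\<^sup>2 / c\<^sup>2)" .
  have "C\<^sup>2 / c\<^sup>2 \<le> 1" using cos_phase_sq_le[OF re, of z] z c by (simp add: d a_K_def)
  then have "K * (C\<^sup>2 / c\<^sup>2) \<le> K * 1" using K by (intro mult_left_mono) auto
  then have MK: "\<bar>M\<bar> \<le> K" unfolding M using K by simp
  have nu: "nu \<alpha> z = 2 * s\<^sup>2 * (S\<^sup>2 + b\<^sup>2 * C\<^sup>2)"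
    using nu_eq[OF re, of z] z by (simp add: d a_K_def)
  have "(\<Sum>k=1..n. (cmod (sine_vec \<alpha> n z k))\<^sup>2) = 2 * s\<^sup>2 * (S\<^sup>2 * (real n - M) + b\<^sup>2 * C\<^sup>2 * (real n + M))"
  proof -
    have "sin z \<noteq> 0" using s c sinz by simp
    then have "(\<Sum>k=1..n. (cmod (sine_vec \<alpha> n z k))\<^sup>2)
        = 2 * (sin (z / 2))\<^sup>2 * ((sin (real n * z / 2))\<^sup>2 * (real n - M)
          + (Im \<alpha> / Re \<alpha>)\<^sup>2 * (cos (real n * z / 2))\<^sup>2 * (real n + M))"
      using re lap_angle_even_closing[OF re j] unfolding M_def z_def
      by (intro norm_sine_vec_closed_form) auto
    then show ?thesis unfolding e power_mult_distrib e2 by (simp add: d)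
  qed
  then have "(\<Sum>k=1..n. (cmod (sine_vec \<alpha> n z k))\<^sup>2) - real n * nu \<alpha> z = 2 * s\<^sup>2 * (M * (b\<^sup>2 * C\<^sup>2 - S\<^sup>2))"
    unfolding nu by (simp add: algebra_simps)
  also have "\<bar>\<dots>\<bar> = 2 * s\<^sup>2 * (\<bar>M\<bar> * \<bar>b\<^sup>2 * C\<^sup>2 - S\<^sup>2\<bar>)"
    by (simp add: abs_mult)
  also have "\<dots> \<le> 2 * s\<^sup>2 * (K * (S\<^sup>2 + b\<^sup>2 * C\<^sup>2))"
    using K MK by (intro mult_left_mono mult_mono) (auto simp: abs_le_iff)
  also have "\<dots> = kappa (Re \<alpha>) * nu \<alpha> z" unfolding nu by (simp add: a_K_def)
  finally show ?thesis .
qed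

lemma abs_sqrt_diff_le:
  fixes x y :: real
  assumes "0 \<le> x" "0 < y"
  shows "\<bar>sqrt x - sqrt y\<bar> \<le> \<bar>x - y\<bar> / sqrt y"
proof -
  have "\<bar>sqrt x - sqrt y\<bar> * sqrt y \<le> \<bar>sqrt x - sqrt y\<bar> * (sqrt x + sqrt y)"
    using assms by (intro mult_left_mono) auto
  also have "\<dots> = \<bar>(sqrt x - sqrt y) * (sqrt x + sqrt y)\<bar>" using assms by (simp add: abs_mult)
  also have "(sqrt x - sqrt y) * (sqrt x + sqrt y) = x - y"
    using assms by (simp add: algebra_simps)
  finally show ?thesis using assms by (simp add: pos_le_divide_eq)
qed

text \<open>Two errors of order \<open>1 / \<surd>n\<close>: replacing \<open>\<parallel>v\<parallel>\<close> by \<open>\<surd>(\<nu>(z) n)\<close> costs at most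
\<open>\<kappa> \<nu>(z) / \<surd>(\<nu>(z) n)\<close>, and moving from \<open>z\<close> to the node costs \<open>\<surd>n\<close> times the Lipschitz constant times \<open>\<pi> / n\<close>.\<close>

lemma eigvec_norm_even:
  assumes re: "Re \<alpha> < 0" and j: "even j" "4 \<le> j" "j \<le> n"
    and ev: "lap_eigval \<alpha> n j = gfun (lap_angle (Re \<alpha>) n j)"
  shows "\<bar>eigvec_norm \<alpha> n j - sqrt (nu \<alpha> (node n j) * real n)\<bar>
    \<le> (kappa (Re \<alpha>) + 1) * (sqrt 2 * (1 + \<bar>Im \<alpha> / Re \<alpha>\<bar>) * (1 + kappa (Re \<alpha>)) * pi) / sqrt (real n)"
proof -
  define z u K L where "z = lap_angle (Re \<alpha>) n j" "u = node n j" "K = kappa (Re \<alpha>)"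
    "L = sqrt 2 * (1 + \<bar>Im \<alpha> / Re \<alpha>\<bar>) * (1 + kappa (Re \<alpha>))"
  note d = z_u_K_L_def
  have n: "0 < real n" using j by simp
  have K: "1 < K" using kappa_gt_1[OF re] by (simp add: d)
  have L: "0 \<le> L" using K by (simp add: d)
  have z: "0 < z" "z < pi" using lap_angle_pos[OF re, of j n] lap_angle_range[OF re, of j n] j by (auto simp: d)
  have u: "0 \<le> u" "u < pi" using node_less_pi[of j n] j by (auto simp: d node_def)
  define X where "X = (\<Sum>k=1..n. (cmod (sine_vec \<alpha> n z k))\<^sup>2)"
  have "zeta \<alpha> n j = z" using zeta_eq_lap_angle[OF re _ _ ev] j by (simp add: d)
  then have norm: "eigvec_norm \<alpha> n j = sqrt X" using eigvec_norm_eq_sine_vec[of j \<alpha> n] j by (simp add: X_def)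
  have X: "\<bar>X - real n * nu \<alpha> z\<bar> \<le> K * nu \<alpha> z"
    using norm_sine_vec_approx_nu[OF re j] by (simp add: X_def d)
  have lip: "\<bar>sqrt (nu \<alpha> x) - sqrt (nu \<alpha> y)\<bar> \<le> L * \<bar>x - y\<bar>" if "0 \<le> x" "x < pi" "0 \<le> y" "y < pi" for x y
    using sqrt_nu_Lipschitz[OF re that] by (simp add: d)
  \<comment> \<open>\<open>\<nu>\<close> vanishes at 0, so its Lipschitz bound also bounds its size.\<close>
  have "nu \<alpha> 0 = 0" using nu_eq[OF re, of 0] by simp
  then have nuz: "sqrt (nu \<alpha> z) \<le> L * pi"
    using lip[of z 0] z L mult_left_mono[of z pi L] by simp
  have nu0: "0 < nu \<alpha> z"
  proof -
    have "0 < sin (z / 2)" using z by (intro sin_gt_zero) auto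
    moreover have "0 < sin (phase (Re \<alpha>) z)"
      using phase_bounds[OF re z] by (intro sin_gt_zero) auto
    ultimately show ?thesis using nu_eq[OF re, of z] z by (simp add: add_pos_nonneg)
  qed
  have "\<bar>sqrt X - sqrt (real n * nu \<alpha> z)\<bar> \<le> \<bar>X - real n * nu \<alpha> z\<bar> / sqrt (real n * nu \<alpha> z)"
    using n nu0 by (intro abs_sqrt_diff_le) (auto simp: X_def intro: sum_nonneg)
  also have "\<dots> \<le> K * nu \<alpha> z / sqrt (real n * nu \<alpha> z)"
    using X n nu0 by (intro divide_right_mono) auto
  also have "\<dots> = K * sqrt (nu \<alpha> z) / sqrt (real n)"
    using nu0 n by (simp add: real_sqrt_mult field_simps)
  also have "\<dots> \<le> K * (L * pi) / sqrt (real n)"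
    using nuz K by (intro divide_right_mono mult_left_mono) auto
  finally have 1: "\<bar>sqrt X - sqrt (real n * nu \<alpha> z)\<bar> \<le> K * (L * pi) / sqrt (real n)" .
  have "\<bar>z - u\<bar> \<le> pi / real n"
  proof -
    have "real n * z = real n * u + eta (Re \<alpha>) z"
      using lap_angle_even(3)[OF re j] n by (simp add: d node_def)
    moreover have "\<bar>eta (Re \<alpha>) z\<bar> \<le> pi"
      using phase_bounds[OF re z] z by (simp add: eta_eq_phase)
    ultimately have "real n * \<bar>z - u\<bar> \<le> pi"
      using n by (metis abs_mult abs_of_nat add_diff_cancel_left' right_diff_distrib)
    then show ?thesis using n by (simp add: field_simps)
  qed
  then have "L * \<bar>z - u\<bar> \<le> L * (pi / real n)" using L by (rule mult_left_mono)
  then have "\<bar>sqrt (nu \<alpha> z) - sqrt (nu \<alpha> u)\<bar> \<le> L * (pi / real n)"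
    using lip[of z u] z u by linarith
  then have "sqrt (real n) * \<bar>sqrt (nu \<alpha> z) - sqrt (nu \<alpha> u)\<bar> \<le> sqrt (real n) * (L * (pi / real n))"
    by (intro mult_left_mono) auto
  moreover have "sqrt (real n) * (L * (pi / real n)) = L * pi / sqrt (real n)"
    using n by (simp add: field_simps)
  moreover have "sqrt (real n * nu \<alpha> z) - sqrt (nu \<alpha> u * real n) = sqrt (real n) * (sqrt (nu \<alpha> z) - sqrt (nu \<alpha> u))"
    by (simp add: real_sqrt_mult algebra_simps)
  ultimately have 2: "\<bar>sqrt (real n * nu \<alpha> z) - sqrt (nu \<alpha> u * real n)\<bar> \<le> L * pi / sqrt (real n)"
    by (simp add: abs_mult)
  have "\<bar>sqrt X - sqrt (nu \<alpha> u * real n)\<bar> \<le> K * (L * pi) / sqrt (real n) + L * pi / sqrt (real n)"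
    using 1 2 by linarith
  also have "\<dots> = (K + 1) * (L * pi) / sqrt (real n)"
    by (simp add: add_divide_distrib distrib_right)
  finally show ?thesis unfolding norm by (simp only: d)
qed

section \<open>Norm of the hyperbolic eigenvector\<close>

lemma sum_cosh_odd_multiples:
  fixes z \<psi> :: real
  shows "sinh z * (\<Sum>k=1..n. cosh ((2 * real k - 1) * z - \<psi>)) = sinh (real n * z) * cosh (real n * z - \<psi>)"
proof (induction n)
  case (Suc n)
  have prod: "sinh x * cosh y = (sinh (x + y) + sinh (x - y)) / 2" for x y :: real
    by (simp add: sinh_add sinh_diff)
  have "sinh z * (\<Sum>k=1..Suc n. cosh ((2 * real k - 1) * z - \<psi>))
      = sinh (real n * z) * cosh (real n * z - \<psi>) + sinh z * cosh ((2 * real n + 1) * z - \<psi>)"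
    using Suc by (simp add: distrib_left algebra_simps)
  also have "\<dots> = (sinh (2 * (real n * z) - \<psi>) + sinh \<psi>) / 2
      + (sinh ((2 * real n + 2) * z - \<psi>) + sinh (\<psi> - 2 * (real n * z))) / 2"
    unfolding prod by (simp add: algebra_simps)
  also have "\<dots> = (sinh ((2 * real n + 2) * z - \<psi>) + sinh \<psi>) / 2"
    using sinh_minus[of "2 * (real n * z) - \<psi>"] by (simp add: add_divide_distrib diff_divide_distrib)
  also have "\<dots> = sinh (real (Suc n) * z) * cosh (real (Suc n) * z - \<psi>)"
    unfolding prod by (simp add: algebra_simps)
  finally show ?case .
qed simp

definition sinh_vec :: "complex \<Rightarrow> nat \<Rightarrow> real \<Rightarrow> nat \<Rightarrow> complex" where
  "sinh_vec \<alpha> n z k = of_real (sinh (real k * z))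
     - (1 - cnj \<alpha>) * of_real (sinh ((real k - 1) * z))
     + cnj \<alpha> * of_real (sinh ((real n - real k) * z))"

lemma sinh_differences:
  fixes z :: real
  shows "sinh (real k * z) - sinh ((real k - 1) * z) = 2 * sinh (z / 2) * cosh ((2 * real k - 1) * z / 2)"
    and "sinh ((real k - 1) * z) + sinh ((real n - real k) * z)
         = 2 * sinh (real n * z / 2 - z / 2) * cosh ((2 * real k - 1) * z / 2 - real n * z / 2)"
proof -
  have minus: "2 * sinh x * cosh y = sinh (y + x) - sinh (y - x)"
    and plus: "2 * sinh x * cosh y = sinh (x + y) + sinh (x - y)" for x y :: real
    by (simp_all add: sinh_add sinh_diff)
  have "(2 * real k - 1) * z / 2 + z / 2 = real k * z" "(2 * real k - 1) * z / 2 - z / 2 = (real k - 1) * z"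
    by (simp_all add: field_simps)
  then show "sinh (real k * z) - sinh ((real k - 1) * z) = 2 * sinh (z / 2) * cosh ((2 * real k - 1) * z / 2)"
    unfolding minus by simp
  have "real n * z / 2 - z / 2 + ((2 * real k - 1) * z / 2 - real n * z / 2) = (real k - 1) * z"
       "real n * z / 2 - z / 2 - ((2 * real k - 1) * z / 2 - real n * z / 2) = (real n - real k) * z"
    by (simp_all add: field_simps)
  then show "sinh ((real k - 1) * z) + sinh ((real n - real k) * z)
         = 2 * sinh (real n * z / 2 - z / 2) * cosh ((2 * real k - 1) * z / 2 - real n * z / 2)"
    unfolding plus by simp
qed

text \<open>The hyperbolic counterpart of \<open>sine_vec_closed_form\<close>, by the same cancellation.\<close>

lemma sinh_vec_closed_form:
  fixes z :: real and n :: nat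
  defines "h \<equiv> z / 2" and "\<phi> \<equiv> real n * z / 2"
  assumes a: "Re \<alpha> \<noteq> 0"
    and closing: "(1 - Re \<alpha>) * sinh h * cosh \<phi> + Re \<alpha> * sinh \<phi> * cosh h = 0"
  shows "sinh_vec \<alpha> n z k = Complex (2 * sinh h * sinh \<phi> * sinh ((2 * real k - 1) * h - \<phi>))
           (2 * (Im \<alpha> / Re \<alpha>) * sinh h * cosh \<phi> * cosh ((2 * real k - 1) * h - \<phi>))"
proof -
  define \<theta> where "\<theta> = (2 * real k - 1) * h"
  have *: "Re \<alpha> * sinh (\<phi> - h) = - (sinh h * cosh \<phi>)"
    using closing by (simp add: sinh_diff algebra_simps)
  then have **: "sinh (\<phi> - h) = - (sinh h * cosh \<phi>) / Re \<alpha>"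
    using a by (simp add: field_simps)
  have "sinh_vec \<alpha> n z k = of_real (sinh (real k * z) - sinh ((real k - 1) * z))
      + cnj \<alpha> * of_real (sinh ((real k - 1) * z) + sinh ((real n - real k) * z))"
    unfolding sinh_vec_def by (simp add: algebra_simps)
  then have v: "sinh_vec \<alpha> n z k = of_real (2 * sinh h * cosh \<theta>) + cnj \<alpha> * of_real (2 * sinh (\<phi> - h) * cosh (\<theta> - \<phi>))"
    unfolding sinh_differences \<theta>_def h_def \<phi>_def by simp
  have "Re (sinh_vec \<alpha> n z k) = 2 * sinh h * cosh \<theta> + 2 * (Re \<alpha> * sinh (\<phi> - h)) * cosh (\<theta> - \<phi>)"
    unfolding v by simp
  also have "\<dots> = 2 * sinh h * (cosh ((\<theta> - \<phi>) + \<phi>) - cosh \<phi> * cosh (\<theta> - \<phi>))"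
    unfolding * by (simp add: algebra_simps)
  also have "\<dots> = 2 * sinh h * sinh \<phi> * sinh (\<theta> - \<phi>)"
    unfolding cosh_add by (simp add: algebra_simps)
  finally have "Re (sinh_vec \<alpha> n z k) = 2 * sinh h * sinh \<phi> * sinh (\<theta> - \<phi>)" .
  moreover have "Im (sinh_vec \<alpha> n z k) = 2 * (Im \<alpha> / Re \<alpha>) * sinh h * cosh \<phi> * cosh (\<theta> - \<phi>)"
    unfolding v ** by simp
  ultimately show ?thesis unfolding complex_eq_iff \<theta>_def by simp
qed

lemma norm_sinh_vec_closed_form:
  fixes z :: real and n :: nat
  defines "h \<equiv> z / 2" and "\<phi> \<equiv> real n * z / 2" and "M \<equiv> sinh (real n * z) / sinh z"
  assumes a: "Re \<alpha> \<noteq> 0" and z: "z \<noteq> 0"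
    and closing: "(1 - Re \<alpha>) * sinh h * cosh \<phi> + Re \<alpha> * sinh \<phi> * cosh h = 0"
  shows "(\<Sum>k=1..n. (cmod (sinh_vec \<alpha> n z k))\<^sup>2)
    = 2 * (sinh h)\<^sup>2 * ((sinh \<phi>)\<^sup>2 * (M - real n) + (Im \<alpha> / Re \<alpha>)\<^sup>2 * (cosh \<phi>)\<^sup>2 * (M + real n))"
proof -
  define c where "c k = cosh ((2 * real k - 1) * z - real n * z)" for k
  have M: "(\<Sum>k=1..n. c k) = M"
    using sum_cosh_odd_multiples[of z "real n * z" n] z by (simp add: c_def M_def field_simps)
  have sq: "2 * (sinh ((2 * real k - 1) * h - \<phi>))\<^sup>2 = c k - 1"
      "2 * (cosh ((2 * real k - 1) * h - \<phi>))\<^sup>2 = c k + 1" for k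
  proof -
    have "c k = cosh (2 * ((2 * real k - 1) * h - \<phi>))" by (simp add: c_def h_def \<phi>_def algebra_simps)
    then show "2 * (sinh ((2 * real k - 1) * h - \<phi>))\<^sup>2 = c k - 1"
      "2 * (cosh ((2 * real k - 1) * h - \<phi>))\<^sup>2 = c k + 1"
      unfolding cosh_double by (simp_all add: cosh_square_eq)
  qed
  have id: "(2 * p * q * u)\<^sup>2 + (2 * b * p * r * w)\<^sup>2
      = 2 * p\<^sup>2 * (q\<^sup>2 * (2 * u\<^sup>2) + b\<^sup>2 * r\<^sup>2 * (2 * w\<^sup>2))" for p q r u w b :: real
    by (simp add: power2_eq_square algebra_simps)
  have "(cmod (sinh_vec \<alpha> n z k))\<^sup>2
      = 2 * (sinh h)\<^sup>2 * ((sinh \<phi>)\<^sup>2 * (c k - 1) + (Im \<alpha> / Re \<alpha>)\<^sup>2 * (cosh \<phi>)\<^sup>2 * (c k + 1))" for k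
    unfolding sinh_vec_closed_form[OF a closing[unfolded h_def \<phi>_def], folded h_def \<phi>_def]
      cmod_power2 sq[symmetric] complex.sel by (rule id)
  then show ?thesis
    using M by (simp add: sum.distrib sum_subtractf flip: sum_distrib_left)
qed

text \<open>With \<open>S = sinh \<phi>\<close>, \<open>C = cosh \<phi>\<close> and \<open>q = e\<^sup>n\<^sup>s\<close>, the closing equation gives
\<open>2 sinh\<^sup>2 (s / 2) M = 2 S\<^sup>2 / \<kappa>\<close> for \<open>M = sinh (n s) / sinh s\<close>. The main part of the squared norm is therefore
\<open>(2 S\<^sup>2 / \<kappa>) (S\<^sup>2 + \<beta> C\<^sup>2)\<close>. Its leading term \<open>(2 / \<kappa>) (1 + \<beta>) S\<^sup>2 C\<^sup>2\<close> is
\<open>(1 + \<beta>) (q - 1 / q)\<^sup>2 / (8 \<kappa>)\<close>, and \<open>(1 + \<beta>) / (8 \<kappa>) = \<mu>\<^sup>2\<close>. All else is bounded by a multiple of \<open>n q\<close>.\<close>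

lemma norm_sinh_vec_leading_term:
  fixes s :: real and n :: nat
  assumes re: "Re \<alpha> < 0" and s: "0 < s" and n: "0 < n"
    and closing: "(1 - Re \<alpha>) * sinh (s / 2) * cosh (real n * s / 2)
       + Re \<alpha> * sinh (real n * s / 2) * cosh (s / 2) = 0"
  shows "\<bar>(\<Sum>k=1..n. (cmod (sinh_vec \<alpha> n s k))\<^sup>2) - (mu \<alpha> * exp (real n * s))\<^sup>2\<bar>
    \<le> (1 + (Im \<alpha> / Re \<alpha>)\<^sup>2) * (3 + 2 * (sinh (s / 2))\<^sup>2) * (real n * exp (real n * s))"
proof -
  define a K \<beta> where "a = Re \<alpha>" "K = kappa a" "\<beta> = (Im \<alpha> / Re \<alpha>)\<^sup>2"
  define S C p c q where "S = sinh (real n * s / 2)" "C = cosh (real n * s / 2)"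
    "p = sinh (s / 2)" "c = cosh (s / 2)" "q = exp (real n * s)"
  note d = S_C_p_c_q_def
  have a: "a < 0" using re by (simp add: a_K_\<beta>_def)
  have K: "1 < K" using kappa_gt_1[OF a] by (simp add: a_K_\<beta>_def)
  have aK: "a * K = a - 1" using a by (simp add: a_K_\<beta>_def kappa_def)
  have \<beta>: "0 \<le> \<beta>" by (simp add: a_K_\<beta>_def)
  have pos: "0 < S" "0 < C" "0 < p" "0 < c" using s n by (auto simp: d)
  have q: "1 \<le> q" using s by (simp add: d)
  have Sc: "S * c = K * C * p"
  proof -
    have "a * (S * c) = (a - 1) * (p * C)" using closing by (simp add: d a_K_\<beta>_def algebra_simps)
    also have "\<dots> = a * (K * C * p)" unfolding aK[symmetric] by simp
    finally show ?thesis using a by simp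
  qed
  have C2: "C\<^sup>2 = 1 + S\<^sup>2" by (simp add: d cosh_square_eq)
  have SC: "2 * S * C = (q - inverse q) / 2" and CC: "2 * C\<^sup>2 - 1 = (q + inverse q) / 2"
    using sinh_double[of "real n * s / 2"] cosh_double_cosh[of "real n * s / 2"]
    by (simp_all add: d sinh_field_def[of "real n * s"] cosh_field_def[of "real n * s"] exp_minus)
  have iq: "0 \<le> inverse q" "inverse q \<le> 1" using q by (simp_all add: inverse_le_1_iff)
  have "x \<le> y" if "2 * x - 1 = (y + r) / 2" "r \<le> 1" "1 \<le> y" for x y r :: real
    using that by argo
  from this[OF CC iq(2) q] have Cq: "C\<^sup>2 \<le> q" .
  have Sq: "S\<^sup>2 \<le> q" using Cq C2 by linarith
  have M: "sinh (real n * s) / sinh s = S * C / (p * c)"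
    using sinh_double[of "real n * s / 2"] sinh_double[of "s / 2"] by (simp add: d)
  \<comment> \<open>The factor \<open>M\<close> is of order \<open>q\<close>; by \<open>S c = \<kappa> C p\<close> it is traded for \<open>S\<^sup>2\<close>.\<close>
  have pM: "2 * p\<^sup>2 * (S * C / (p * c)) = 2 * S\<^sup>2 / K"
  proof -
    have "2 * p\<^sup>2 * (S * C / (p * c)) = 2 * p * C * S / c"
      using pos by (simp add: power2_eq_square)
    also have "\<dots> = 2 * (S * c) * S / (K * c)" unfolding Sc using K by simp
    also have "\<dots> = 2 * S\<^sup>2 / K" using pos by (simp add: power2_eq_square)
    finally show ?thesis .
  qed
  have "(mu \<alpha>)\<^sup>2 = (1 + \<beta>) / (8 * K)"
  proof -
    have pos': "0 < a\<^sup>2 - a" using a zero_le_power2[of a] by linarith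
    have "(mu \<alpha>)\<^sup>2 = (a\<^sup>2 + (Im \<alpha>)\<^sup>2) / (8 * (a\<^sup>2 - a))"
      using pos' by (simp add: mu_def power_divide power_mult_distrib cmod_power2 flip: a_K_\<beta>_def)
    also have "a\<^sup>2 - a = a\<^sup>2 * K"
      unfolding power2_eq_square mult.assoc aK by (simp add: algebra_simps)
    also have "a\<^sup>2 + (Im \<alpha>)\<^sup>2 = a\<^sup>2 * (1 + \<beta>)"
      using a unfolding a_K_\<beta>_def by (simp add: power_divide distrib_left)
    finally show ?thesis using a by simp
  qed
  then have mu: "(mu \<alpha> * q)\<^sup>2 = (1 + \<beta>) / (8 * K) * q\<^sup>2" by (simp add: power_mult_distrib)
  have distr: "x * (u - 2 + v) = x * u + x * (v - 2)" for x u v :: real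
    by (simp add: algebra_simps)
  have regroup: "2 * p\<^sup>2 * (S\<^sup>2 * (m - real n) + \<beta> * C\<^sup>2 * (m + real n))
      = 2 * p\<^sup>2 * m * (S\<^sup>2 + \<beta> * C\<^sup>2) + 2 * p\<^sup>2 * real n * (\<beta> * C\<^sup>2 - S\<^sup>2)" for m
    by (simp add: algebra_simps)
  have "(\<Sum>k=1..n. (cmod (sinh_vec \<alpha> n s k))\<^sup>2)
      = 2 * p\<^sup>2 * (S\<^sup>2 * (S * C / (p * c) - real n) + \<beta> * C\<^sup>2 * (S * C / (p * c) + real n))"
    using norm_sinh_vec_closed_form[of \<alpha> s n] re s closing
    by (simp add: M a_K_\<beta>_def(3) flip: d a_K_\<beta>_def(1))
  also have "\<dots> = 2 * p\<^sup>2 * (S * C / (p * c)) * (S\<^sup>2 + \<beta> * C\<^sup>2) + 2 * p\<^sup>2 * real n * (\<beta> * C\<^sup>2 - S\<^sup>2)"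
    by (rule regroup)
  also have "2 * p\<^sup>2 * (S * C / (p * c)) * (S\<^sup>2 + \<beta> * C\<^sup>2) = (1 + \<beta>) / (8 * K) * (2 * (2 * S * C))\<^sup>2 - 2 * S\<^sup>2 / K"
    unfolding pM power_mult_distrib C2 using K by (simp add: field_simps power2_eq_square)
  also have "(2 * (2 * S * C))\<^sup>2 = q\<^sup>2 - 2 + (inverse q)\<^sup>2"
  proof -
    have double: "2 * (2 * S * C) = q - inverse q" unfolding SC by simp
    have "2 * q * inverse q = 2" using q by simp
    then show ?thesis unfolding double power2_diff by linarith
  qed
  finally have X: "(\<Sum>k=1..n. (cmod (sinh_vec \<alpha> n s k))\<^sup>2) - (mu \<alpha> * q)\<^sup>2
      = (1 + \<beta>) / (8 * K) * ((inverse q)\<^sup>2 - 2) - 2 * S\<^sup>2 / K + 2 * p\<^sup>2 * real n * (\<beta> * C\<^sup>2 - S\<^sup>2)"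
    unfolding mu distr by linarith
  have nq: "q \<le> real n * q" "1 \<le> real n * q"
    using n q mult_mono[of 1 "real n" 1 q] mult_right_mono[of 1 "real n" q] by auto
  have "\<bar>(1 + \<beta>) / (8 * K) * ((inverse q)\<^sup>2 - 2)\<bar> \<le> (1 + \<beta>) / 8 * 2"
  proof -
    have "(inverse q)\<^sup>2 \<le> 1" using iq by (simp add: power_le_one)
    then have "\<bar>(inverse q)\<^sup>2 - 2\<bar> \<le> 2" by simp
    moreover have "(1 + \<beta>) / (8 * K) \<le> (1 + \<beta>) / 8" using K \<beta> by (intro divide_left_mono) auto
    ultimately show ?thesis unfolding abs_mult using K \<beta> by (intro mult_mono) auto
  qed
  also have "\<dots> \<le> (1 + \<beta>) * 1" using \<beta> by simp
  also have "\<dots> \<le> (1 + \<beta>) * (real n * q)" using nq \<beta> by (intro mult_left_mono) auto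
  finally have 1: "\<bar>(1 + \<beta>) / (8 * K) * ((inverse q)\<^sup>2 - 2)\<bar> \<le> (1 + \<beta>) * (real n * q)" .
  have "\<bar>2 * S\<^sup>2 / K\<bar> \<le> 2 * S\<^sup>2 / 1" using K divide_left_mono[of 1 K "2 * S\<^sup>2"] by simp
  also have "\<dots> \<le> 2 * ((1 + \<beta>) * (real n * q))"
  proof -
    have "real n * q \<le> (1 + \<beta>) * (real n * q)"
      using nq \<beta> mult_right_mono[of 1 "1 + \<beta>" "real n * q"] by simp
    then show ?thesis using Sq nq by linarith
  qed
  also have "\<dots> = (1 + \<beta>) * 2 * (real n * q)" by simp
  finally have 2: "\<bar>2 * S\<^sup>2 / K\<bar> \<le> (1 + \<beta>) * 2 * (real n * q)" .
  have "\<bar>\<beta> * C\<^sup>2 - S\<^sup>2\<bar> \<le> (1 + \<beta>) * q"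
  proof -
    have "\<bar>\<beta> * C\<^sup>2 - S\<^sup>2\<bar> \<le> \<beta> * C\<^sup>2 + S\<^sup>2" using \<beta> by (simp add: abs_le_iff)
    also have "\<dots> \<le> \<beta> * q + q" using Cq Sq \<beta> by (intro add_mono mult_left_mono)
    finally show ?thesis by (simp add: algebra_simps)
  qed
  then have "2 * p\<^sup>2 * real n * \<bar>\<beta> * C\<^sup>2 - S\<^sup>2\<bar> \<le> 2 * p\<^sup>2 * real n * ((1 + \<beta>) * q)"
    by (intro mult_left_mono) auto
  moreover have "\<bar>2 * p\<^sup>2 * real n * (\<beta> * C\<^sup>2 - S\<^sup>2)\<bar> = 2 * p\<^sup>2 * real n * \<bar>\<beta> * C\<^sup>2 - S\<^sup>2\<bar>"
    by (simp add: abs_mult)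
  ultimately have 3: "\<bar>2 * p\<^sup>2 * real n * (\<beta> * C\<^sup>2 - S\<^sup>2)\<bar> \<le> (1 + \<beta>) * (2 * p\<^sup>2) * (real n * q)"
    by (simp only: mult_ac)
  have "\<bar>(\<Sum>k=1..n. (cmod (sinh_vec \<alpha> n s k))\<^sup>2) - (mu \<alpha> * q)\<^sup>2\<bar>
      \<le> (1 + \<beta>) * (real n * q) + (1 + \<beta>) * 2 * (real n * q) + (1 + \<beta>) * (2 * p\<^sup>2) * (real n * q)"
    unfolding X using 1 2 3 by linarith
  also have "\<dots> = (1 + \<beta>) * (3 + 2 * p\<^sup>2) * (real n * q)" by (simp add: algebra_simps)
  finally show ?thesis by (simp add: d a_K_\<beta>_def)
qed

text \<open>From \<open>\<omega> - e\<^sup>s = (\<omega>\<^sup>2 - 1) / (q + \<omega>)\<close> one gets \<open>(\<omega> / e\<^sup>s)\<^sup>n \<le> e\<^sup>x\<close> with \<open>x = n (\<omega>\<^sup>2 - 1) / q\<close>, hence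
\<open>\<omega>\<^sup>n - q \<le> q (e\<^sup>x - 1) \<le> q x e\<^sup>x\<close>. Here \<open>q x\<close> is linear in \<open>n\<close>, and \<open>x\<close> is bounded because \<open>q \<ge> n s\<^sub>0\<close>.\<close>

lemma exp_approximates_power:
  fixes s a :: real and n :: nat
  defines "q \<equiv> exp (real n * s)" and "\<omega> \<equiv> 1 - 2 * a"
  assumes a: "a < 0" and s0: "0 < s0" "s0 \<le> s" and n: "0 < n"
    and closing: "(1 - a) * sinh (s / 2) * cosh (real n * s / 2) + a * sinh (real n * s / 2) * cosh (s / 2) = 0"
  shows "\<bar>q - \<omega> ^ n\<bar> \<le> (\<omega>\<^sup>2 - 1) * exp ((\<omega>\<^sup>2 - 1) / s0) * real n"
proof -
  define e where "e = exp s"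
  define D where "D = \<omega>\<^sup>2 - 1"
  have \<omega>: "1 < \<omega>" using a by (simp add: \<omega>_def)
  then have D: "0 < D" by (simp add: D_def one_less_power)
  have e: "1 < e" using s0 by (simp add: e_def)
  have q: "0 < q" "q = e ^ n" by (simp_all add: q_def e_def exp_of_nat_mult)
  have nq: "real n / q \<le> 1 / s0"
  proof -
    have "real n * s0 \<le> real n * s" using s0 by (intro mult_left_mono) auto
    also have "\<dots> \<le> q" unfolding q_def using exp_ge_add_one_self[of "real n * s"] by linarith
    finally show ?thesis using q s0 by (simp add: field_simps)
  qed
  have half: "2 * (exp x * sinh (x / 2)) = exp (x / 2) * (exp x - 1)"
      "2 * (exp x * cosh (x / 2)) = exp (x / 2) * (exp x + 1)" for x :: real
    by (simp_all add: sinh_field_def cosh_field_def exp_minus field_simps flip: exp_add)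
  \<comment> \<open>The closing equation in exponentials, after cancelling \<open>e\<^sup>s\<^sup>/\<^sup>2\<close> and \<open>e\<^sup>n\<^sup>s\<^sup>/\<^sup>2\<close>.\<close>
  have "(1 - a) * ((e - 1) * (q + 1)) + a * ((q - 1) * (e + 1)) = 0"
  proof -
    have "0 = 4 * (e * q) * ((1 - a) * sinh (s / 2) * cosh (real n * s / 2) + a * sinh (real n * s / 2) * cosh (s / 2))"
      unfolding closing by simp
    also have "\<dots> = (1 - a) * (2 * (e * sinh (s / 2))) * (2 * (q * cosh (real n * s / 2)))
        + a * (2 * (q * sinh (real n * s / 2))) * (2 * (e * cosh (s / 2)))"
      by (simp add: algebra_simps)
    also have "\<dots> = (exp (s / 2) * exp (real n * s / 2)) * ((1 - a) * ((e - 1) * (q + 1)) + a * ((q - 1) * (e + 1)))"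
      unfolding e_def q_def half by (simp add: algebra_simps)
    finally show ?thesis by simp
  qed
  then have "(\<omega> - e) * (q + \<omega>) = D" unfolding \<omega>_def D_def by (simp add: algebra_simps power2_eq_square)
  then have we: "\<omega> - e = D / (q + \<omega>)" using q \<omega> by (simp add: field_simps)
  then have "\<omega> - e > 0" using D q \<omega> by simp
  have "\<omega> / e \<le> 1 + D / q"
  proof -
    have "D / (q + \<omega>) \<le> D / q" using D q \<omega> by (intro divide_left_mono) auto
    also have "\<dots> \<le> D / q * e" using D q e mult_left_mono[of 1 e "D / q"] by simp
    finally show ?thesis using we e by (simp add: field_simps)
  qed
  also have "\<dots> \<le> exp (D / q)" by (rule exp_ge_add_one_self)
  finally have "(\<omega> / e) ^ n \<le> exp (D / q) ^ n" using e \<omega> by (intro power_mono) auto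
  also have "\<dots> = exp (real n * D / q)" by (simp add: exp_of_nat_mult[symmetric])
  finally have r: "\<omega> ^ n \<le> q * exp (real n * D / q)"
    using q by (simp add: power_divide field_simps)
  have "\<omega> ^ n - q \<le> q * (exp (real n * D / q) - 1)" using r by (simp add: algebra_simps)
  also have "\<dots> \<le> q * (real n * D / q * exp (real n * D / q))"
  proof (intro mult_left_mono)
    show "exp x - 1 \<le> x * exp x" for x :: real
    proof -
      have "exp x * (1 - x) \<le> exp x * exp (- x)"
        using exp_ge_add_one_self[of "- x"] by (intro mult_left_mono) auto
      then show ?thesis by (simp add: exp_minus algebra_simps)
    qed
  qed (use q in auto)
  also have "\<dots> = D * real n * exp (D * (real n / q))" using q(1) by (simp add: mult_ac)
  also have "\<dots> \<le> D * real n * exp (D * (1 / s0))" using mult_left_mono[OF nq, of D] D by (intro mult_left_mono) auto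
  finally have "\<omega> ^ n - q \<le> D * exp (D / s0) * real n" by (simp add: mult_ac)
  moreover have "q \<le> \<omega> ^ n" unfolding q(2) using \<open>\<omega> - e > 0\<close> e by (intro power_mono) auto
  ultimately show ?thesis by (simp add: D_def)
qed

lemma eigvec_norm_first:
  assumes re: "Re \<alpha> < 0"
  shows "\<exists>C. \<forall>n\<ge>N_min (Re \<alpha>). \<bar>eigvec_norm \<alpha> n 1 - mu \<alpha> * (1 - 2 * Re \<alpha>) ^ n\<bar> \<le> C * real n"
proof -
  define a where "a = Re \<alpha>"
  obtain s0 where s0: "0 < s0" "\<And>n. N_min a \<le> n \<Longrightarrow> \<exists>s. s0 \<le> s \<and> s \<le> ln (1 - 2 * a) \<and>
      (1 - a) * sinh (s / 2) * cosh (real n * s / 2) + a * sinh (real n * s / 2) * cosh (s / 2) = 0"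
    using uniform_hyperbolic_roots[OF re] unfolding a_def by blast
  define P where "P = (1 + (Im \<alpha> / Re \<alpha>)\<^sup>2) * (3 + 2 * (sinh (ln (1 - 2 * a) / 2))\<^sup>2)"
  define D where "D = (1 - 2 * a)\<^sup>2 - 1"
  have mu: "0 < mu \<alpha>"
  proof -
    have "0 < (Re \<alpha>)\<^sup>2 - Re \<alpha>" using re zero_le_power2[of "Re \<alpha>"] by linarith
    moreover have "\<alpha> \<noteq> 0" using re by auto
    ultimately show ?thesis by (simp add: mu_def)
  qed
  have "\<bar>eigvec_norm \<alpha> n 1 - mu \<alpha> * (1 - 2 * a) ^ n\<bar> \<le> (P / mu \<alpha> + mu \<alpha> * (D * exp (D / s0))) * real n"
    if N: "N_min a \<le> n" for n
  proof -
    have n: "3 \<le> n" using N N_min_ge_3[of a] by simp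
    obtain s where s: "s0 \<le> s" "s \<le> ln (1 - 2 * a)"
        "(1 - a) * sinh (s / 2) * cosh (real n * s / 2) + a * sinh (real n * s / 2) * cosh (s / 2) = 0"
      using s0(2)[OF N] by blast
    note closing = s(3)[unfolded a_def]
    have spos: "0 < s" using s0 s by simp
    define q where "q = exp (real n * s)"
    define X where "X = (\<Sum>k=1..n. (cmod (sinh_vec \<alpha> n s k))\<^sup>2)"
    have "sparam \<alpha> n = s"
      by (rule sparam_eq[OF spos lap_eigval_eq(1)[OF n re spos closing]])
    then have norm: "eigvec_norm \<alpha> n 1 = sqrt X"
      by (simp add: X_def eigvec_norm_def L2_set_def eigvec_def sinh_vec_def)
    have q: "0 < q" by (simp add: q_def)
    have "\<bar>X - (mu \<alpha> * q)\<^sup>2\<bar> \<le> (1 + (Im \<alpha> / Re \<alpha>)\<^sup>2) * (3 + 2 * (sinh (s / 2))\<^sup>2) * (real n * q)"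
      using norm_sinh_vec_leading_term[OF re spos _ closing] n by (simp add: X_def q_def)
    also have "\<dots> \<le> P * (real n * q)"
    proof -
      have "(sinh (s / 2))\<^sup>2 \<le> (sinh (ln (1 - 2 * a) / 2))\<^sup>2"
        using s spos by (intro power_mono) auto
      then show ?thesis unfolding P_def using q by (intro mult_right_mono mult_left_mono) auto
    qed
    finally have X: "\<bar>X - (mu \<alpha> * q)\<^sup>2\<bar> \<le> P * (real n * q)" .
    have "\<bar>sqrt X - sqrt ((mu \<alpha> * q)\<^sup>2)\<bar> \<le> \<bar>X - (mu \<alpha> * q)\<^sup>2\<bar> / sqrt ((mu \<alpha> * q)\<^sup>2)"
      using mu q by (intro abs_sqrt_diff_le) (auto simp: X_def intro: sum_nonneg)
    also have "sqrt ((mu \<alpha> * q)\<^sup>2) = mu \<alpha> * q" using mu q by simp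
    also have "\<bar>X - (mu \<alpha> * q)\<^sup>2\<bar> / (mu \<alpha> * q) \<le> P * (real n * q) / (mu \<alpha> * q)"
      using X mu q by (intro divide_right_mono) auto
    also have "\<dots> = P / mu \<alpha> * real n" using q by simp
    finally have 1: "\<bar>sqrt X - mu \<alpha> * q\<bar> \<le> P / mu \<alpha> * real n" .
    have "\<bar>q - (1 - 2 * a) ^ n\<bar> \<le> D * exp (D / s0) * real n"
      using exp_approximates_power[OF _ s0(1) s(1) _ s(3)] n re by (simp add: q_def D_def a_def)
    then have "mu \<alpha> * \<bar>q - (1 - 2 * a) ^ n\<bar> \<le> mu \<alpha> * (D * exp (D / s0) * real n)"
      using mu by (intro mult_left_mono) auto
    then have 2: "\<bar>mu \<alpha> * q - mu \<alpha> * (1 - 2 * a) ^ n\<bar> \<le> mu \<alpha> * (D * exp (D / s0) * real n)"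
      using mu by (simp add: abs_mult flip: right_diff_distrib)
    have "\<bar>sqrt X - mu \<alpha> * (1 - 2 * a) ^ n\<bar> \<le> P / mu \<alpha> * real n + mu \<alpha> * (D * exp (D / s0) * real n)"
      using 1 2 by linarith
    then show ?thesis unfolding norm by (simp add: distrib_right mult.assoc)
  qed
  then show ?thesis unfolding a_def by blast
qed

section \<open>Asymptotics of the norms\<close>

theorem theorem2p6:
  fixes \<alpha> :: complex
  assumes "Re \<alpha> < 0"
  shows
    "(\<forall>n j. N_min (Re \<alpha>) \<le> n \<and> odd j \<and> 3 \<le> j \<and> j \<le> n \<longrightarrow>
        eigvec_norm \<alpha> n j = cmod (1 - \<alpha>) * sqrt (real n / 2 * lap_eigval \<alpha> n j))
     \<and> (\<exists>C::real. \<forall>n j. N_min (Re \<alpha>) \<le> n \<and> even j \<and> 4 \<le> j \<and> j \<le> n \<longrightarrow>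
        \<bar>eigvec_norm \<alpha> n j - sqrt (nu \<alpha> (node n j) * real n)\<bar> \<le> C / sqrt (real n))
     \<and> (\<lambda>n. eigvec_norm \<alpha> n 1 - mu \<alpha> * (1 - 2 * Re \<alpha>) ^ n) \<in> O[sequentially](\<lambda>n. real n)"
proof (intro conjI)
  show "\<forall>n j. N_min (Re \<alpha>) \<le> n \<and> odd j \<and> 3 \<le> j \<and> j \<le> n \<longrightarrow>
        eigvec_norm \<alpha> n j = cmod (1 - \<alpha>) * sqrt (real n / 2 * lap_eigval \<alpha> n j)"
    using eigvec_norm_odd[OF assms] lap_eigval_eq_gfun_lap_angle[OF assms] by simp
  have "\<forall>n j. N_min (Re \<alpha>) \<le> n \<and> even j \<and> 4 \<le> j \<and> j \<le> n \<longrightarrow>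
        \<bar>eigvec_norm \<alpha> n j - sqrt (nu \<alpha> (node n j) * real n)\<bar>
        \<le> (kappa (Re \<alpha>) + 1) * (sqrt 2 * (1 + \<bar>Im \<alpha> / Re \<alpha>\<bar>) * (1 + kappa (Re \<alpha>)) * pi) / sqrt (real n)"
    using eigvec_norm_even[OF assms] lap_eigval_eq_gfun_lap_angle[OF assms] by simp
  then show "\<exists>C::real. \<forall>n j. N_min (Re \<alpha>) \<le> n \<and> even j \<and> 4 \<le> j \<and> j \<le> n \<longrightarrow>
        \<bar>eigvec_norm \<alpha> n j - sqrt (nu \<alpha> (node n j) * real n)\<bar> \<le> C / sqrt (real n)"
    by blast
  obtain C where C: "\<And>n. N_min (Re \<alpha>) \<le> n \<Longrightarrow>
      \<bar>eigvec_norm \<alpha> n 1 - mu \<alpha> * (1 - 2 * Re \<alpha>) ^ n\<bar> \<le> C * real n"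
    using eigvec_norm_first[OF assms] by blast
  show "(\<lambda>n. eigvec_norm \<alpha> n 1 - mu \<alpha> * (1 - 2 * Re \<alpha>) ^ n) \<in> O[sequentially](\<lambda>n. real n)"
    by (rule bigoI[where c = C], rule eventually_sequentiallyI[of "N_min (Re \<alpha>)"]) (use C in simp)
qed

end
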